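(* Let $(M,g)$ be a Riemannian manifold of dimension $n>3$ and $\tau:M\to\mathbb{R}$ a nonconstant $C^\infty$ function. Suppose that there are $C^\infty$ functions $\alpha,\gamma$ on $M$ with $$\alpha\,\nabla d\tau+\mathrm r=\gamma\, g\quad\text{on } M,$$ where $\nabla d\tau$ is the Hessian of $\tau$ and $\mathrm r$ is the Ricci tensor of $g$. Then on $M\smallsetminus\tau^{-1}(0)$ the pair $(\widehat g,\widehat\tau)=(g/\tau^2,1/\tau)$ satisfies $$\widehat\alpha\,\widehat\nabla d\widehat\tau+\widehat{\mathrm r}=\widehat\gamma\,\widehat g,$$ where $\widehat\nabla d\widehat\tau$ and $\widehat{\mathrm r}$ are the Hessian of $\widehat\tau$ and the Ricci tensor with respect to $\widehat g$, and $$\widehat\alpha=(n-2)\tau-\tau^2\alpha,\qquad \widehat\gamma=\gamma\tau^2-(1+\alpha\tau)Q+\tau\Delta\tau .$$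
   Context: Here $Q=g(\nabla\tau,\nabla\tau)$ and $\Delta\tau=\mathrm{tr}_g\nabla d\tau$ is the Laplacian with respect to $g$. *)

theory Defs
  imports "HOL-Analysis.Analysis"
begin

section \<open>Smooth maps between Euclidean spaces\<close>

text \<open>Only used on open sets. Directional derivatives are required along all vectors.\<close>

primrec Ck_on :: "nat \<Rightarrow> ('a::euclidean_space \<Rightarrow> 'b::euclidean_space) \<Rightarrow> 'a set \<Rightarrow> bool" where
  "Ck_on 0 f S \<longleftrightarrow> continuous_on S f"
| "Ck_on (Suc k) f S \<longleftrightarrow> (\<forall>x\<in>S. f differentiable (at x)) \<and>
     (\<forall>v. Ck_on k (\<lambda>x. frechet_derivative f (at x) v) S)"

definition smooth_on :: "('a::euclidean_space \<Rightarrow> 'b::euclidean_space) \<Rightarrow> 'a set \<Rightarrow> bool" where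
  "smooth_on f S \<longleftrightarrow> (\<forall>k. Ck_on k f S)"


section \<open>Smooth manifolds\<close>

text \<open>A chart is a pair of a domain and a coordinate map. The dimension of the manifold is
  \<^term>\<open>CARD('n)\<close>, and the underlying space is an abstract topology, so that open
  submanifolds are again manifolds in the same sense.\<close>

type_synonym ('a, 'n) chart = "'a set \<times> ('a \<Rightarrow> real ^ 'n)"

definition chart_image :: "('a, 'n::finite) chart \<Rightarrow> (real ^ 'n) set" where
  "chart_image c = snd c ` fst c"

definition in_chart :: "('a, 'n::finite) chart \<Rightarrow> ('a \<Rightarrow> 'b) \<Rightarrow> real ^ 'n \<Rightarrow> 'b" where
  "in_chart c f = f \<circ> inv_into (fst c) (snd c)"

definition topological_chart :: "'a topology \<Rightarrow> ('a, 'n::finite) chart \<Rightarrow> bool" where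
  "topological_chart X c \<longleftrightarrow> openin X (fst c) \<and> open (chart_image c) \<and>
     homeomorphic_map (subtopology X (fst c)) (top_of_set (chart_image c)) (snd c)"

text \<open>The atlas need not be maximal.\<close>

definition smooth_manifold :: "'a topology \<Rightarrow> ('a, 'n::finite) chart set \<Rightarrow> bool" where
  "smooth_manifold X A \<longleftrightarrow> Hausdorff_space X \<and> second_countable X \<and>
     (\<forall>c\<in>A. topological_chart X c) \<and> (\<Union>c\<in>A. fst c) = topspace X \<and>
     (\<forall>c\<in>A. \<forall>d\<in>A. smooth_on (in_chart c (snd d)) (snd c ` (fst c \<inter> fst d)))"

definition smooth_fun_on :: "('a, 'n::finite) chart set \<Rightarrow> 'a set \<Rightarrow> ('a \<Rightarrow> real) \<Rightarrow> bool" where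
  "smooth_fun_on A U f \<longleftrightarrow> (\<forall>c\<in>A. smooth_on (in_chart c f) (snd c ` (fst c \<inter> U)))"

definition restrict_atlas :: "'a set \<Rightarrow> ('a, 'n::finite) chart set \<Rightarrow> ('a, 'n) chart set" where
  "restrict_atlas U A = (\<lambda>c. (fst c \<inter> U, snd c)) ` A"


section \<open>Tangent vectors and Riemannian metrics\<close>

text \<open>Tangent vectors at \<open>p\<close> are derivations at \<open>p\<close> of the real functions that are smooth near \<open>p\<close>.
  They depend only on germs: if \<open>f\<close> and \<open>h\<close> agree on a neighbourhood \<open>U\<close> of \<open>p\<close>,
  multiply by the indicator function of \<open>U\<close>, which is smooth near \<open>p\<close> and killed by
  derivations. On functions that are not smooth near \<open>p\<close> they are set to 0.\<close>

type_synonym 'a tvec = "('a \<Rightarrow> real) \<Rightarrow> real"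

definition smooth_near ::
  "'a topology \<Rightarrow> ('a, 'n::finite) chart set \<Rightarrow> 'a \<Rightarrow> ('a \<Rightarrow> real) \<Rightarrow> bool" where
  "smooth_near X A p f \<longleftrightarrow> (\<exists>U. openin X U \<and> p \<in> U \<and> smooth_fun_on A U f)"

definition tangent_space ::
  "'a topology \<Rightarrow> ('a, 'n::finite) chart set \<Rightarrow> 'a \<Rightarrow> 'a tvec set" where
  "tangent_space X A p = {v.
     (\<forall>f. \<not> smooth_near X A p f \<longrightarrow> v f = 0) \<and>
     (\<forall>f h a b. smooth_near X A p f \<longrightarrow> smooth_near X A p h \<longrightarrow>
        v (\<lambda>q. a * f q + b * h q) = a * v f + b * v h) \<and>
     (\<forall>f h. smooth_near X A p f \<longrightarrow> smooth_near X A p h \<longrightarrow>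
        v (\<lambda>q. f q * h q) = f p * v h + h p * v f)}"

definition partial :: "'n \<Rightarrow> (real ^ 'n::finite \<Rightarrow> real) \<Rightarrow> real ^ 'n \<Rightarrow> real" where
  "partial i f x = frechet_derivative f (at x) (axis i 1)"

definition coord_vec ::
  "'a topology \<Rightarrow> ('a, 'n::finite) chart set \<Rightarrow> ('a, 'n) chart \<Rightarrow> 'a \<Rightarrow> 'n \<Rightarrow> 'a tvec" where
  "coord_vec X A c p i f =
     (if smooth_near X A p f then partial i (in_chart c f) (snd c p) else 0)"

text \<open>The metric as a matrix-valued function on the image of a chart.\<close>

definition metric_in_chart ::
  "'a topology \<Rightarrow> ('a, 'n::finite) chart set \<Rightarrow> ('a \<Rightarrow> 'a tvec \<Rightarrow> 'a tvec \<Rightarrow> real)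
     \<Rightarrow> ('a, 'n) chart \<Rightarrow> real ^ 'n \<Rightarrow> real ^ 'n ^ 'n" where
  "metric_in_chart X A g c =
     in_chart c (\<lambda>p. \<chi> i j. g p (coord_vec X A c p i) (coord_vec X A c p j))"

definition riemannian_metric ::
  "'a topology \<Rightarrow> ('a, 'n::finite) chart set \<Rightarrow> ('a \<Rightarrow> 'a tvec \<Rightarrow> 'a tvec \<Rightarrow> real) \<Rightarrow> bool" where
  "riemannian_metric X A g \<longleftrightarrow>
     (\<forall>p\<in>topspace X. \<forall>u\<in>tangent_space X A p. \<forall>v\<in>tangent_space X A p. \<forall>w\<in>tangent_space X A p.
        g p v w = g p w v \<and>
        (\<forall>a b. g p (\<lambda>f. a * u f + b * v f) w = a * g p u w + b * g p v w) \<and>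
        (v \<noteq> (\<lambda>f. 0) \<longrightarrow> g p v v > 0)) \<and>
     (\<forall>c\<in>A. smooth_on (metric_in_chart X A g c) (chart_image c))"

definition riemannian_manifold ::
  "'a topology \<Rightarrow> ('a, 'n::finite) chart set \<Rightarrow> ('a \<Rightarrow> 'a tvec \<Rightarrow> 'a tvec \<Rightarrow> real) \<Rightarrow> bool" where
  "riemannian_manifold X A g \<longleftrightarrow> smooth_manifold X A \<and> riemannian_metric X A g"


section \<open>Levi-Civita connection and curvature in local coordinates\<close>

text \<open>Tensor fields and scalars derived from the metric are given by their expressions in a chart;
  equations between them are to be read in every chart of the atlas.
  Below, \<open>G\<close> is the matrix of the metric and \<open>f\<close> a function, both expressed in a
  chart. The Levi-Civita connection is \<open>\<nabla>\<^sub>i \<partial>\<^sub>j = (\<Sum>k. \<Gamma> k i j \<partial>\<^sub>k)\<close>.\<close>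

definition christoffel ::
  "(real ^ 'n::finite \<Rightarrow> real ^ 'n ^ 'n) \<Rightarrow> 'n \<Rightarrow> 'n \<Rightarrow> 'n \<Rightarrow> real ^ 'n \<Rightarrow> real" where
  "christoffel G k i j x = (1/2) * (\<Sum>l\<in>UNIV. matrix_inv (G x) $ k $ l *
     (partial i (\<lambda>y. G y $ j $ l) x + partial j (\<lambda>y. G y $ i $ l) x
        - partial l (\<lambda>y. G y $ i $ j) x))"

text \<open>Covariant derivative \<open>(\<nabla>\<^sub>i \<omega>)\<^sub>j\<close> of a 1-form with components \<open>\<omega> j\<close>.\<close>

definition covariant_derivative ::
  "(real ^ 'n::finite \<Rightarrow> real ^ 'n ^ 'n) \<Rightarrow> ('n \<Rightarrow> real ^ 'n \<Rightarrow> real)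
     \<Rightarrow> 'n \<Rightarrow> 'n \<Rightarrow> real ^ 'n \<Rightarrow> real" where
  "covariant_derivative G \<omega> i j x =
     partial i (\<omega> j) x - (\<Sum>k\<in>UNIV. christoffel G k i j x * \<omega> k x)"

definition hessian ::
  "(real ^ 'n::finite \<Rightarrow> real ^ 'n ^ 'n) \<Rightarrow> (real ^ 'n \<Rightarrow> real)
     \<Rightarrow> 'n \<Rightarrow> 'n \<Rightarrow> real ^ 'n \<Rightarrow> real" where
  "hessian G f = covariant_derivative G (\<lambda>j. partial j f)"

text \<open>\<open>R(\<partial>\<^sub>i, \<partial>\<^sub>j) \<partial>\<^sub>k = (\<Sum>l. riemann G l k i j \<partial>\<^sub>l)\<close>, where
  \<open>R(u, v) w = \<nabla>\<^sub>u \<nabla>\<^sub>v w - \<nabla>\<^sub>v \<nabla>\<^sub>u w - \<nabla>\<^bsub>[u, v]\<^esub> w\<close>.\<close>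

definition riemann ::
  "(real ^ 'n::finite \<Rightarrow> real ^ 'n ^ 'n) \<Rightarrow> 'n \<Rightarrow> 'n \<Rightarrow> 'n \<Rightarrow> 'n \<Rightarrow> real ^ 'n \<Rightarrow> real" where
  "riemann G l k i j x =
     partial i (christoffel G l j k) x - partial j (christoffel G l i k) x
     + (\<Sum>m\<in>UNIV. christoffel G l i m x * christoffel G m j k x
          - christoffel G l j m x * christoffel G m i k x)"

text \<open>\<open>r(v, w)\<close> is the trace of \<open>u \<mapsto> R(u, v) w\<close>; round spheres have positive Ricci curvature.\<close>

definition ricci ::
  "(real ^ 'n::finite \<Rightarrow> real ^ 'n ^ 'n) \<Rightarrow> 'n \<Rightarrow> 'n \<Rightarrow> real ^ 'n \<Rightarrow> real" where
  "ricci G j k x = (\<Sum>i\<in>UNIV. riemann G i k i j x)"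

definition laplacian ::
  "(real ^ 'n::finite \<Rightarrow> real ^ 'n ^ 'n) \<Rightarrow> (real ^ 'n \<Rightarrow> real) \<Rightarrow> real ^ 'n \<Rightarrow> real" where
  "laplacian G f x = (\<Sum>i\<in>UNIV. \<Sum>j\<in>UNIV. matrix_inv (G x) $ i $ j * hessian G f i j x)"

definition gradient ::
  "(real ^ 'n::finite \<Rightarrow> real ^ 'n ^ 'n) \<Rightarrow> (real ^ 'n \<Rightarrow> real) \<Rightarrow> real ^ 'n \<Rightarrow> real ^ 'n" where
  "gradient G f x = (\<chi> i. \<Sum>j\<in>UNIV. matrix_inv (G x) $ i $ j * partial j f x)"

definition grad_square ::
  "(real ^ 'n::finite \<Rightarrow> real ^ 'n ^ 'n) \<Rightarrow> (real ^ 'n \<Rightarrow> real) \<Rightarrow> real ^ 'n \<Rightarrow> real" where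
  "grad_square G f x =
     (\<Sum>i\<in>UNIV. \<Sum>j\<in>UNIV. G x $ i $ j * gradient G f x $ i * gradient G f x $ j)"

end

theory Submission
  imports Defs
begin

text \<open>
  The statement is pointwise and local, so it is an identity in one chart. Write \<open>n\<close> for the
  dimension and \<open>H = \<nabla>d\<tau>\<close>. For a conformal metric \<open>exp (- 2 \<phi>) g\<close> the Christoffel symbols change by a
  tensor built from \<open>d\<phi>\<close>, its gradient and \<open>g\<close> (\<open>christoffel_conformal\<close>). Inserting this into the
  coordinate formula for the Ricci tensor gives the classical law (\<open>ricci_conformal\<close>)

    \<open>r + (n - 2) (\<nabla>d\<phi> + d\<phi> \<otimes> d\<phi>) + (\<Delta>\<phi> - (n - 2) g(\<nabla>\<phi>, \<nabla>\<phi>)) g\<close>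

  for the new Ricci tensor. With \<open>\<phi> = ln \<bar>\<tau>\<bar>\<close> the metric is \<open>g / \<tau>\<^sup>2\<close>, and the chain rule turns this into

    \<open>r + (n - 2) H / \<tau> + (\<Delta>\<tau> / \<tau> - (n - 1) Q / \<tau>\<^sup>2) g\<close>,

  while the new Hessian of \<open>1 / \<tau>\<close> is \<open>- H / \<tau>\<^sup>2 + Q g / \<tau>\<^sup>3\<close>. Thus both new tensors are combinations
  of \<open>r\<close>, \<open>H\<close> and \<open>g\<close>. The new coefficient of the Hessian, \<open>(n - 2) \<tau> - \<tau>\<^sup>2 \<alpha>\<close>, is the one for which
  \<open>H\<close> occurs in the sum with coefficient \<open>\<alpha>\<close>; the hypothesis replaces \<open>\<alpha> H + r\<close> by \<open>\<gamma> g\<close>, and the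
  coefficients of \<open>g\<close> add up to the asserted function divided by \<open>\<tau>\<^sup>2\<close>.

  The calculus behind this is the rule for partial derivatives of products and sums, the symmetry
  of second derivatives (\<open>second_derivative_symmetric\<close>), differentiability of the inverse matrix by
  Cramer's rule, and \<open>\<nabla>g = 0\<close> (\<open>metric_compatible\<close>).

  To apply it, the matrix of \<open>g\<close> in a chart must be symmetric and invertible
  (\<open>metric_in_chart_local_metric\<close>): the coordinate vectors are derivations, and they are linearly
  independent because they are dual to the coordinate functions. Finally, the set where \<open>\<tau>\<close> does not
  vanish is open, and restricting the manifold to it does not change the coordinate vectors
  (\<open>coord_vec_restrict\<close>), so near each point the restricted data are those of the original chart.
\<close>

section \<open>Partial derivatives and functions of class \<open>C\<^sup>k\<close>\<close>

lemma has_derivative_cong_open: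
  assumes "open U" "x \<in> U" "\<And>y. y \<in> U \<Longrightarrow> f y = g y"
  shows "(f has_derivative D) (at x) \<longleftrightarrow> (g has_derivative D) (at x)"
  using has_derivative_transform_within_open[of f D x UNIV U g]
    has_derivative_transform_within_open[of g D x UNIV U f] assms by metis

lemma frechet_derivative_cong_open:
  assumes "open U" "x \<in> U" "\<And>y. y \<in> U \<Longrightarrow> f y = g y"
  shows "frechet_derivative f (at x) = frechet_derivative g (at x)"
  using has_derivative_cong_open[of U x f g, OF assms] by (simp add: frechet_derivative_def)

lemma differentiable_cong_open:
  assumes "open U" "x \<in> U" "\<And>y. y \<in> U \<Longrightarrow> f y = g y"
  shows "f differentiable (at x) \<longleftrightarrow> g differentiable (at x)"
  using has_derivative_cong_open[of U x f g, OF assms] by (simp add: differentiable_def)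

lemma partial_cong:
  assumes "open U" "x \<in> U" "\<And>y. y \<in> U \<Longrightarrow> f y = g y"
  shows "partial i f x = partial i g x"
  using frechet_derivative_cong_open[of U x f g, OF assms] by (simp add: partial_def)

lemma partialI:
  assumes "(f has_derivative D) (at x)"
  shows "partial i f x = D (axis i 1)"
  using frechet_derivative_at[OF assms] by (simp add: partial_def)

lemma differentiable_has_frechet:
  assumes "f differentiable (at x)"
  shows "(f has_derivative frechet_derivative f (at x)) (at x)"
  using assms frechet_derivative_works by blast

lemma partial_const [simp]: "partial i (\<lambda>y. c) x = 0"
  by (simp add: partial_def)

lemma partial_add:
  assumes "f differentiable (at x)" "g differentiable (at x)"
  shows "partial i (\<lambda>y. f y + g y) x = partial i f x + partial i g x"
  using partialI[OF has_derivative_add[OF assms[THEN differentiable_has_frechet]]]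
  by (simp add: partial_def)

lemma partial_diff:
  assumes "f differentiable (at x)" "g differentiable (at x)"
  shows "partial i (\<lambda>y. f y - g y) x = partial i f x - partial i g x"
  using partialI[OF has_derivative_diff[OF assms[THEN differentiable_has_frechet]]]
  by (simp add: partial_def)

lemma partial_mult:
  fixes f g :: "real ^ 'n::finite \<Rightarrow> real"
  assumes "f differentiable (at x)" "g differentiable (at x)"
  shows "partial i (\<lambda>y. f y * g y) x = f x * partial i g x + partial i f x * g x"
  using partialI[OF has_derivative_mult[OF assms[THEN differentiable_has_frechet]]]
  by (simp add: partial_def)

lemma partial_cmult:
  fixes f :: "real ^ 'n::finite \<Rightarrow> real"
  assumes "f differentiable (at x)"
  shows "partial i (\<lambda>y. c * f y) x = c * partial i f x"
  using partial_mult[OF _ assms, of "\<lambda>y. c"] by simp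

lemma partial_sum:
  assumes "\<And>a. a \<in> I \<Longrightarrow> f a differentiable (at x)"
  shows "partial i (\<lambda>y. \<Sum>a\<in>I. f a y) x = (\<Sum>a\<in>I. partial i (f a) x)"
proof -
  have "((\<lambda>y. \<Sum>a\<in>I. f a y) has_derivative
      (\<lambda>v. \<Sum>a\<in>I. frechet_derivative (f a) (at x) v)) (at x)"
    by (intro has_derivative_sum differentiable_has_frechet assms)
  from partialI[OF this] show ?thesis
    by (simp add: partial_def)
qed

lemma partial_chain:
  fixes f :: "real ^ 'n::finite \<Rightarrow> real"
  assumes "f differentiable (at x)" "(h has_real_derivative d) (at (f x))"
  shows "partial i (\<lambda>y. h (f y)) x = d * partial i f x"
proof -
  have "((\<lambda>y. h (f y)) has_derivative (\<lambda>v. d * frechet_derivative f (at x) v)) (at x)"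
    using has_derivative_compose[OF differentiable_has_frechet[OF assms(1)]
        assms(2)[unfolded has_field_derivative_def]] .
  from partialI[OF this] show ?thesis
    by (simp add: partial_def)
qed

lemma Ck_on_cong:
  assumes "open S" "\<And>x. x \<in> S \<Longrightarrow> f x = g x"
  shows "Ck_on k f S \<longleftrightarrow> Ck_on k g S"
  using assms(2)
proof (induction k arbitrary: f g)
  case 0
  then show ?case by (auto intro: continuous_on_eq)
next
  case (Suc k)
  have "Ck_on k (\<lambda>x. frechet_derivative f (at x) v) S \<longleftrightarrow> Ck_on k (\<lambda>x. frechet_derivative g (at x) v) S"
    for v
    by (rule Suc.IH) (simp add: frechet_derivative_cong_open[of S _ f g, OF assms(1) _ Suc.prems])
  moreover have "f differentiable (at x) \<longleftrightarrow> g differentiable (at x)" if "x \<in> S" for x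
    using differentiable_cong_open[of S x f g, OF assms(1) that Suc.prems] .
  ultimately show ?case
    by simp
qed

lemma Ck_on_subset: "Ck_on k f S \<Longrightarrow> T \<subseteq> S \<Longrightarrow> Ck_on k f T"
  by (induction k arbitrary: f) (auto intro: continuous_on_subset)

lemma Ck_on_Suc_D: "Ck_on (Suc k) f S \<Longrightarrow> Ck_on k f S"
proof (induction k arbitrary: f)
  case 0
  then show ?case
    by (auto intro!: continuous_at_imp_continuous_on differentiable_imp_continuous_within)
next
  case (Suc k)
  then show ?case
    unfolding Ck_on.simps(2)[of "Suc k"] Ck_on.simps(2)[of k] by blast
qed

text \<open>The form in which the closure properties below are proved by induction on the order: it
  suffices to know some derivative on \<open>S\<close> and that this derivative is of class one lower.\<close>

lemma Ck_on_SucI: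
  assumes "open S" "\<And>x. x \<in> S \<Longrightarrow> (f has_derivative D x) (at x)"
    and "\<And>v. Ck_on k (\<lambda>x. D x v) S"
  shows "Ck_on (Suc k) f S"
proof -
  have "frechet_derivative f (at x) v = D x v" if "x \<in> S" for x v
    using frechet_derivative_at[OF assms(2)[OF that]] by simp
  then have "Ck_on k (\<lambda>x. frechet_derivative f (at x) v) S" for v
    using assms(3)[of v] by (subst Ck_on_cong[OF assms(1)]) auto
  then show ?thesis
    using assms(2) by (auto simp: differentiable_def)
qed

lemma Ck_on_SucD:
  assumes "Ck_on (Suc k) f S"
  shows "x \<in> S \<Longrightarrow> (f has_derivative frechet_derivative f (at x)) (at x)"
    and "Ck_on k (\<lambda>x. frechet_derivative f (at x) v) S"
  using assms frechet_derivative_works by auto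

lemma Ck_on_const: "Ck_on k (\<lambda>x. c) S"
  by (induction k arbitrary: c) auto

lemma Ck_on_add:
  assumes "open S" "Ck_on k f S" "Ck_on k g S"
  shows "Ck_on k (\<lambda>x. f x + g x) S"
  using assms(2,3)
proof (induction k arbitrary: f g)
  case 0
  then show ?case by (auto intro: continuous_on_add)
next
  case (Suc k)
  show ?case
    by (rule Ck_on_SucI[OF assms(1) has_derivative_add[OF Suc.prems[THEN Ck_on_SucD(1)]]])
      (assumption | intro Suc.IH Suc.prems[THEN Ck_on_SucD(2)])+
qed

lemma Ck_on_mult:
  fixes f g :: "'a::euclidean_space \<Rightarrow> real"
  assumes "open S" "Ck_on k f S" "Ck_on k g S"
  shows "Ck_on k (\<lambda>x. f x * g x) S"
  using assms(2,3)
proof (induction k arbitrary: f g)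
  case 0
  then show ?case by (auto intro: continuous_on_mult)
next
  case (Suc k)
  show ?case
  proof (rule Ck_on_SucI[OF assms(1) has_derivative_mult[OF Suc.prems[THEN Ck_on_SucD(1)]]])
    fix v
    show "Ck_on k (\<lambda>x. f x * frechet_derivative g (at x) v + frechet_derivative f (at x) v * g x) S"
      by (intro Ck_on_add assms(1) Suc.IH Suc.prems[THEN Ck_on_SucD(2)] Suc.prems[THEN Ck_on_Suc_D])
  qed
qed

lemma Ck_on_inverse:
  fixes f :: "'a::euclidean_space \<Rightarrow> real"
  assumes "open S" "Ck_on k f S" "\<And>x. x \<in> S \<Longrightarrow> f x \<noteq> 0"
  shows "Ck_on k (\<lambda>x. inverse (f x)) S"
  using assms(2)
proof (induction k)
  case 0
  then show ?case using assms(3) by (auto intro!: continuous_on_inverse)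
next
  case (Suc k)
  show ?case
  proof (rule Ck_on_SucI[OF assms(1)])
    fix x assume "x \<in> S"
    then show "((\<lambda>x. inverse (f x)) has_derivative
        (\<lambda>v. - (inverse (f x) * frechet_derivative f (at x) v * inverse (f x)))) (at x)"
      by (intro Deriv.has_derivative_inverse assms(3) Ck_on_SucD(1)[OF Suc.prems])
  next
    fix v
    have "Ck_on k (\<lambda>x. (- 1) * ((inverse (f x) * frechet_derivative f (at x) v) * inverse (f x))) S"
      by (intro Ck_on_mult Ck_on_const assms(1) Suc.IH Ck_on_SucD(2)[OF Suc.prems] Ck_on_Suc_D[OF Suc.prems])
    then show "Ck_on k (\<lambda>x. - (inverse (f x) * frechet_derivative f (at x) v * inverse (f x))) S"
      by simp
  qed
qed

lemma DERIV_ln_abs: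
  fixes x :: real
  assumes "x \<noteq> 0"
  shows "((\<lambda>y. ln \<bar>y\<bar>) has_real_derivative inverse x) (at x)"
proof -
  have "((\<lambda>y. ln (y\<^sup>2) / 2) has_real_derivative inverse x) (at x)"
    using assms by (auto intro!: derivative_eq_intros simp: power2_eq_square field_simps zero_less_mult_iff)
  moreover have "ln (y\<^sup>2) / 2 = ln \<bar>y\<bar>" for y :: real
    using ln_realpow[of "\<bar>y\<bar>" 2] by (cases "y = 0") simp_all
  ultimately show ?thesis by simp
qed

lemma Ck_on_ln_abs:
  fixes f :: "'a::euclidean_space \<Rightarrow> real"
  assumes "open S" "Ck_on k f S" "\<And>x. x \<in> S \<Longrightarrow> f x \<noteq> 0"
  shows "Ck_on k (\<lambda>x. ln \<bar>f x\<bar>) S"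
proof (cases k)
  case 0
  then show ?thesis
    using assms by (simp add: continuous_on_ln continuous_on_rabs)
next
  case (Suc m)
  have f: "Ck_on (Suc m) f S"
    using assms(2) Suc by simp
  show ?thesis unfolding Suc
  proof (rule Ck_on_SucI[OF assms(1)])
    fix x assume x: "x \<in> S"
    from has_derivative_compose[OF Ck_on_SucD(1)[OF f x]
        DERIV_ln_abs[OF assms(3)[OF x], unfolded has_field_derivative_def]]
    show "((\<lambda>x. ln \<bar>f x\<bar>) has_derivative (\<lambda>h. inverse (f x) * frechet_derivative f (at x) h)) (at x)" .
  next
    fix v
    show "Ck_on m (\<lambda>x. inverse (f x) * frechet_derivative f (at x) v) S"
      by (intro Ck_on_mult Ck_on_inverse assms(1,3) f[THEN Ck_on_SucD(2)] f[THEN Ck_on_Suc_D])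
  qed
qed

lemma Ck_on_bounded_linear:
  assumes "open S" "Ck_on k f S" "bounded_linear h"
  shows "Ck_on k (\<lambda>x. h (f x)) S"
  using assms(2)
proof (induction k arbitrary: f)
  case 0
  then show ?case
    using assms(3) by (auto intro: bounded_linear.continuous_on)
next
  case (Suc k)
  show ?case
    by (rule Ck_on_SucI[OF assms(1)
          bounded_linear.has_derivative[OF assms(3) Suc.prems[THEN Ck_on_SucD(1)]]])
      (assumption | intro Suc.IH Suc.prems[THEN Ck_on_SucD(2)])+
qed

lemma Ck_on_component:
  fixes f :: "'a::euclidean_space \<Rightarrow> ('b::euclidean_space) ^ 'n::finite"
  assumes "open S" "Ck_on k f S"
  shows "Ck_on k (\<lambda>x. f x $ j) S"
  using Ck_on_bounded_linear[OF assms bounded_linear_vec_nth] .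

lemma C2_on_partial:
  assumes "Ck_on 2 f U" "x \<in> U"
  shows "f differentiable (at x)" "partial i f differentiable (at x)"
  using assms by (auto simp: numeral_2_eq_2 partial_def[abs_def])

text \<open>Two applications of the mean value theorem express the second difference of \<open>f\<close> along the
  parallelogram with edges \<open>h v\<close> and \<open>h w\<close> by a value of \<open>D\<^sub>w D\<^sub>v f\<close> nearby.\<close>

lemma second_difference_mean_value:
  fixes f :: "'a::euclidean_space \<Rightarrow> real"
  assumes h: "h > 0" and sub: "cball x (h * (norm v + norm w)) \<subseteq> U" and f: "Ck_on 2 f U"
  obtains y where "dist x y \<le> h * (norm v + norm w)"
    "f (x + h *\<^sub>R v + h *\<^sub>R w) - f (x + h *\<^sub>R v) - f (x + h *\<^sub>R w) + f x
     = h\<^sup>2 * frechet_derivative (\<lambda>z. frechet_derivative f (at z) v) (at y) w"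
proof -
  let ?Df = "\<lambda>z. frechet_derivative f (at z) v"
  let ?DDf = "\<lambda>z. frechet_derivative ?Df (at z) w"
  have near: "dist x (x + a *\<^sub>R v + b *\<^sub>R w) \<le> h * (norm v + norm w)"
    if "0 \<le> a" "a \<le> h" "0 \<le> b" "b \<le> h" for a b
  proof -
    have "dist x (x + a *\<^sub>R v + b *\<^sub>R w) = norm (a *\<^sub>R v + b *\<^sub>R w)"
      by (simp add: dist_norm norm_minus_commute algebra_simps)
    also have "\<dots> \<le> a * norm v + b * norm w"
      using norm_triangle_ineq[of "a *\<^sub>R v" "b *\<^sub>R w"] that by simp
    also have "\<dots> \<le> h * norm v + h * norm w"
      using that by (intro add_mono mult_right_mono) auto
    finally show ?thesis by (simp add: algebra_simps)
  qed
  have inU: "x + a *\<^sub>R v + b *\<^sub>R w \<in> U" if "0 \<le> a" "a \<le> h" "0 \<le> b" "b \<le> h" for a b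
    using near[OF that] sub by auto
  have lin: "D (a *\<^sub>R v) = a * D v" if "(g has_derivative D) F" for g :: "'a \<Rightarrow> real" and D F a v
    using linear_scale[OF has_derivative_linear[OF that]] by simp
  have along_v: "((\<lambda>s. f (x + s *\<^sub>R v + b *\<^sub>R w)) has_real_derivative ?Df (x + a *\<^sub>R v + b *\<^sub>R w)) (at a)"
    if "0 \<le> a" "a \<le> h" "0 \<le> b" "b \<le> h" for a b
  proof -
    have D: "(f has_derivative frechet_derivative f (at (x + a *\<^sub>R v + b *\<^sub>R w))) (at (x + a *\<^sub>R v + b *\<^sub>R w))"
      using Ck_on_SucD(1)[OF f[unfolded numeral_2_eq_2] inU[OF that]] .
    have "((\<lambda>s. x + s *\<^sub>R v + b *\<^sub>R w) has_derivative (\<lambda>s. s *\<^sub>R v)) (at a)"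
      by (auto intro!: derivative_eq_intros)
    from has_derivative_compose[OF this D] show ?thesis
      by (simp add: has_field_derivative_def lin[OF D] mult.commute[of _ "?Df _"])
  qed
  have along_w: "((\<lambda>s. ?Df (x + a *\<^sub>R v + s *\<^sub>R w)) has_real_derivative ?DDf (x + a *\<^sub>R v + b *\<^sub>R w)) (at b)"
    if "0 \<le> a" "a \<le> h" "0 \<le> b" "b \<le> h" for a b
  proof -
    have D: "(?Df has_derivative frechet_derivative ?Df (at (x + a *\<^sub>R v + b *\<^sub>R w))) (at (x + a *\<^sub>R v + b *\<^sub>R w))"
      using Ck_on_SucD(1)[OF Ck_on_SucD(2)[OF f[unfolded numeral_2_eq_2]] inU[OF that]] .
    have "((\<lambda>s. x + a *\<^sub>R v + s *\<^sub>R w) has_derivative (\<lambda>s. s *\<^sub>R w)) (at b)"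
      by (auto intro!: derivative_eq_intros)
    from has_derivative_compose[OF this D] show ?thesis
      by (simp add: has_field_derivative_def lin[OF D] mult.commute[of _ "?DDf _"])
  qed
  have "\<exists>a. 0 < a \<and> a < h \<and>
     (f (x + h *\<^sub>R v + h *\<^sub>R w) - f (x + h *\<^sub>R v + 0 *\<^sub>R w))
       - (f (x + 0 *\<^sub>R v + h *\<^sub>R w) - f (x + 0 *\<^sub>R v + 0 *\<^sub>R w))
     = (h - 0) * (?Df (x + a *\<^sub>R v + h *\<^sub>R w) - ?Df (x + a *\<^sub>R v + 0 *\<^sub>R w))"
    by (rule MVT2[OF h]) (use h in \<open>auto intro!: DERIV_diff along_v simp del: scaleR_zero_left add_0_right\<close>)
  then obtain a where a: "0 < a" "a < h" and
    eq1: "f (x + h *\<^sub>R v + h *\<^sub>R w) - f (x + h *\<^sub>R v) - (f (x + h *\<^sub>R w) - f x)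
     = h * (?Df (x + a *\<^sub>R v + h *\<^sub>R w) - ?Df (x + a *\<^sub>R v + 0 *\<^sub>R w))"
    by auto
  have "\<exists>b. 0 < b \<and> b < h \<and> ?Df (x + a *\<^sub>R v + h *\<^sub>R w) - ?Df (x + a *\<^sub>R v + 0 *\<^sub>R w)
     = (h - 0) * ?DDf (x + a *\<^sub>R v + b *\<^sub>R w)"
    by (rule MVT2[OF h]) (use a in \<open>auto intro!: along_w\<close>)
  then obtain b where b: "0 < b" "b < h" and
    eq2: "?Df (x + a *\<^sub>R v + h *\<^sub>R w) - ?Df (x + a *\<^sub>R v + 0 *\<^sub>R w) = h * ?DDf (x + a *\<^sub>R v + b *\<^sub>R w)"
    by auto
  show ?thesis
  proof
    show "dist x (x + a *\<^sub>R v + b *\<^sub>R w) \<le> h * (norm v + norm w)"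
      using near a b by simp
    show "f (x + h *\<^sub>R v + h *\<^sub>R w) - f (x + h *\<^sub>R v) - f (x + h *\<^sub>R w) + f x
       = h\<^sup>2 * ?DDf (x + a *\<^sub>R v + b *\<^sub>R w)"
      using eq1 unfolding eq2 by (simp add: power2_eq_square)
  qed
qed

text \<open>Schwarz: the second difference is symmetric in the two edges, so both iterated derivatives
  are its limit.\<close>

lemma second_derivative_symmetric:
  fixes f :: "'a::euclidean_space \<Rightarrow> real"
  assumes "open U" "x \<in> U" and f: "Ck_on 2 f U"
  shows "frechet_derivative (\<lambda>z. frechet_derivative f (at z) v) (at x) w
       = frechet_derivative (\<lambda>z. frechet_derivative f (at z) w) (at x) v"
proof -
  define q where "q h = (f (x + h *\<^sub>R v + h *\<^sub>R w) - f (x + h *\<^sub>R v) - f (x + h *\<^sub>R w) + f x) / h\<^sup>2" for h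
  have lim: "(q \<longlongrightarrow> frechet_derivative (\<lambda>z. frechet_derivative f (at z) v) (at x) w) (at_right 0)"
    if q: "\<And>h. q h = (f (x + h *\<^sub>R v + h *\<^sub>R w) - f (x + h *\<^sub>R v) - f (x + h *\<^sub>R w) + f x) / h\<^sup>2"
    for v w
  proof (rule tendstoI)
    let ?DDf = "\<lambda>z. frechet_derivative (\<lambda>z. frechet_derivative f (at z) v) (at z) w"
    fix e :: real assume "e > 0"
    have "continuous_on U ?DDf"
      using f by (auto simp: numeral_2_eq_2)
    then have "isCont ?DDf x"
      using assms by (simp add: continuous_on_eq_continuous_at)
    then obtain d where d: "d > 0" "\<And>y. dist y x < d \<Longrightarrow> dist (?DDf y) (?DDf x) < e"
      using \<open>e > 0\<close> unfolding continuous_at_eps_delta by blast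
    obtain r where r: "r > 0" "ball x r \<subseteq> U"
      using assms openE by blast
    define \<delta> where "\<delta> = min d r / (norm v + norm w + 1)"
    have "\<delta> > 0" using d r by (simp add: \<delta>_def add_nonneg_pos)
    have "dist (q h) (?DDf x) < e" if "0 < h" "h < \<delta>" for h
    proof -
      have "h * (norm v + norm w) \<le> h * (norm v + norm w + 1)"
        using \<open>0 < h\<close> by simp
      also have "\<dots> < min d r"
        using that unfolding \<delta>_def by (subst (asm) pos_less_divide_eq) (simp_all add: add_nonneg_pos)
      finally have small: "h * (norm v + norm w) < min d r" .
      then have "cball x (h * (norm v + norm w)) \<subseteq> U"
        using r by (auto simp: subset_iff)
      from second_difference_mean_value[OF \<open>0 < h\<close> this f]
      obtain y where y: "dist x y \<le> h * (norm v + norm w)"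
        and "f (x + h *\<^sub>R v + h *\<^sub>R w) - f (x + h *\<^sub>R v) - f (x + h *\<^sub>R w) + f x
             = h\<^sup>2 * ?DDf y" .
      then have qy: "q h = ?DDf y"
        unfolding q using \<open>0 < h\<close> by simp
      have "dist y x < d"
        using y small by (simp add: dist_commute)
      then show ?thesis
        using d(2) unfolding qy by simp
    qed
    then show "\<forall>\<^sub>F h in at_right 0. dist (q h) (?DDf x) < e"
      using \<open>\<delta> > 0\<close> unfolding eventually_at_right_field by blast
  qed
  have "q h = (f (x + h *\<^sub>R w + h *\<^sub>R v) - f (x + h *\<^sub>R w) - f (x + h *\<^sub>R v) + f x) / h\<^sup>2" for h
  proof -
    have "x + h *\<^sub>R w + h *\<^sub>R v = x + h *\<^sub>R v + h *\<^sub>R w"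
      by (simp only: ac_simps)
    show ?thesis unfolding q_def \<open>x + h *\<^sub>R w + h *\<^sub>R v = _\<close> by simp
  qed
  from tendsto_unique[OF trivial_limit_at_right_real lim[OF q_def] lim[OF this]]
  show ?thesis .
qed

lemma partial_commute:
  assumes "open U" "x \<in> U" "Ck_on 2 f U"
  shows "partial i (partial j f) x = partial j (partial i f) x"
  using second_derivative_symmetric[OF assms, of "axis j 1" "axis i 1"]
  by (simp add: partial_def[abs_def])

section \<open>Metrics on open subsets of Euclidean space\<close>

lemma matrix_inv_inverse:
  fixes A :: "real ^ 'n ^ 'n::finite"
  assumes "invertible A"
  shows "A ** matrix_inv A = mat 1" "matrix_inv A ** A = mat 1"
  using someI_ex[OF assms[unfolded invertible_def]] by (auto simp: matrix_inv_def)

lemma matrix_inv_unique: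
  fixes A B :: "real ^ 'n ^ 'n::finite"
  assumes "A ** B = mat 1"
  shows "matrix_inv A = B"
proof -
  have "invertible A"
    using assms invertible_right_inverse by blast
  then have "matrix_inv A = matrix_inv A ** (A ** B)"
    by (simp add: assms)
  also have "\<dots> = B"
    using matrix_inv_inverse(2)[OF \<open>invertible A\<close>] by (simp add: matrix_mul_assoc)
  finally show ?thesis .
qed

lemma matrix_inv_scaleR:
  fixes A :: "real ^ 'n ^ 'n::finite"
  assumes "invertible A" "a \<noteq> 0"
  shows "matrix_inv (a *\<^sub>R A) = inverse a *\<^sub>R matrix_inv A"
proof (rule matrix_inv_unique)
  have "(a *\<^sub>R A) ** (inverse a *\<^sub>R matrix_inv A) = (a * inverse a) *\<^sub>R (A ** matrix_inv A)"
    by (simp add: vec_eq_iff matrix_matrix_mult_def sum_distrib_left mult.assoc mult.left_commute)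
  then show "(a *\<^sub>R A) ** (inverse a *\<^sub>R matrix_inv A) = mat 1"
    using assms matrix_inv_inverse(1) by simp
qed

lemma differentiable_det:
  fixes M :: "'a::real_normed_vector \<Rightarrow> real ^ 'n ^ 'n::finite"
  assumes "\<And>i j. (\<lambda>y. M y $ i $ j) differentiable (at x)"
  shows "(\<lambda>y. det (M y)) differentiable (at x)"
proof -
  have "(\<lambda>y. \<Prod>i\<in>UNIV. M y $ i $ p i) differentiable (at x)" for p :: "'n \<Rightarrow> 'n"
  proof -
    have "((\<lambda>y. M y $ i $ p i) has_derivative frechet_derivative (\<lambda>y. M y $ i $ p i) (at x)) (at x)"
      for i
      using assms frechet_derivative_works by blast
    then show ?thesis
      unfolding differentiable_def by (intro exI) (rule has_derivative_prod, assumption)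
  qed
  then show ?thesis
    unfolding det_def by (intro differentiable_sum ballI differentiable_mult) auto
qed

text \<open>By Cramer's rule the entries of the inverse are quotients of determinants.\<close>

lemma matrix_inv_cramer:
  fixes A :: "real ^ 'n ^ 'n::finite"
  assumes "invertible A"
  shows "matrix_inv A $ k $ l
    = det (\<chi> i j. if j = k then (if i = l then 1 else 0) else A $ i $ j) / det A"
proof -
  have "det A \<noteq> 0"
    using assms invertible_det_nz by blast
  have "A *v (matrix_inv A *v axis l 1) = axis l 1"
    by (simp add: matrix_vector_mul_assoc matrix_inv_inverse(1)[OF assms])
  then have "matrix_inv A *v axis l 1
    = (\<chi> k. det (\<chi> i j. if j = k then axis l 1 $ i else A $ i $ j) / det A)"
    using cramer[OF \<open>det A \<noteq> 0\<close>] by blast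
  then have "(matrix_inv A *v axis l 1) $ k
    = det (\<chi> i j. if j = k then (if i = l then 1 else 0) else A $ i $ j) / det A"
    by (simp only: vec_lambda_beta) (simp only: axis_def vec_lambda_beta)
  then show ?thesis
    by (simp add: matrix_vector_mul_component inner_axis)
qed

lemma differentiable_matrix_inv:
  fixes G :: "'a::real_normed_vector \<Rightarrow> real ^ 'n ^ 'n::finite"
  assumes "open U" "x \<in> U" and inv: "\<And>y. y \<in> U \<Longrightarrow> invertible (G y)"
    and G: "\<And>i j. (\<lambda>y. G y $ i $ j) differentiable (at x)"
  shows "(\<lambda>y. matrix_inv (G y) $ k $ l) differentiable (at x)"
proof -
  let ?N = "\<lambda>y. \<chi> i j. if j = k then (if i = l then 1 else 0) else G y $ i $ j"
  have "(\<lambda>y. ?N y $ i $ j) differentiable (at x)" for i j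
    using G by (cases "j = k") simp_all
  then have "(\<lambda>y. det (?N y) / det (G y)) differentiable (at x)"
    using G inv[OF \<open>x \<in> U\<close>] by (intro differentiable_divide differentiable_det) (auto simp: invertible_det_nz)
  moreover have "matrix_inv (G y) $ k $ l = det (?N y) / det (G y)" if "y \<in> U" for y
    by (rule matrix_inv_cramer[OF inv[OF that]])
  ultimately show ?thesis
    using differentiable_cong_open[OF assms(1,2), of "\<lambda>y. matrix_inv (G y) $ k $ l"
        "\<lambda>y. det (?N y) / det (G y)"] by blast
qed

lemma sum_delta:
  fixes f :: "'n::finite \<Rightarrow> real"
  shows "(\<Sum>i\<in>UNIV. mat 1 $ i $ j * f i) = f j" "(\<Sum>i\<in>UNIV. mat 1 $ j $ i * f i) = f j"
    "(\<Sum>i\<in>UNIV. f i * mat 1 $ i $ j) = f j" "(\<Sum>i\<in>UNIV. f i * mat 1 $ j $ i) = f j"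
  by (simp_all add: mat_def if_distrib[of "\<lambda>t. t * _"] if_distrib[of "\<lambda>t. _ * t"] cong: if_cong)

text \<open>The matrix of a metric, of any signature, as a function on the image of a chart.\<close>

locale local_metric =
  fixes U :: "(real ^ 'n::finite) set" and G :: "real ^ 'n \<Rightarrow> real ^ 'n ^ 'n"
  assumes open_domain: "open U"
    and metric_C2: "Ck_on 2 G U"
    and metric_sym: "y \<in> U \<Longrightarrow> G y $ i $ j = G y $ j $ i"
    and metric_invertible: "y \<in> U \<Longrightarrow> invertible (G y)"
begin

abbreviation H :: "real ^ 'n \<Rightarrow> 'n \<Rightarrow> 'n \<Rightarrow> real" where
  "H y k l \<equiv> matrix_inv (G y) $ k $ l"

abbreviation \<Gamma> :: "'n \<Rightarrow> 'n \<Rightarrow> 'n \<Rightarrow> real ^ 'n \<Rightarrow> real" where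
  "\<Gamma> \<equiv> christoffel G"

lemma metric_entry_C2: "Ck_on 2 (\<lambda>y. G y $ i $ j) U"
  by (intro Ck_on_component open_domain metric_C2)

lemma metric_differentiable: "x \<in> U \<Longrightarrow> (\<lambda>y. G y $ i $ j) differentiable (at x)"
  and partial_metric_differentiable:
    "x \<in> U \<Longrightarrow> partial m (\<lambda>y. G y $ i $ j) differentiable (at x)"
  using C2_on_partial[OF metric_entry_C2] by auto

lemma inverse_metric_differentiable: "x \<in> U \<Longrightarrow> (\<lambda>y. H y k l) differentiable (at x)"
  by (rule differentiable_matrix_inv[OF open_domain _ metric_invertible metric_differentiable])

lemma christoffel_differentiable: "x \<in> U \<Longrightarrow> \<Gamma> k i j differentiable (at x)"
  unfolding christoffel_def[abs_def]
  by (intro differentiable_mult differentiable_sum ballI differentiable_add differentiable_diff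
      inverse_metric_differentiable partial_metric_differentiable differentiable_const) auto

lemma metric_inverse:
  assumes "y \<in> U"
  shows "(\<Sum>k\<in>UNIV. G y $ i $ k * H y k j) = mat 1 $ i $ j"
    and "(\<Sum>k\<in>UNIV. H y i k * G y $ k $ j) = mat 1 $ i $ j"
  using matrix_inv_inverse[OF metric_invertible[OF assms]]
  by (simp_all add: vec_eq_iff matrix_matrix_mult_def)

lemma lower_raise:
  assumes "y \<in> U"
  shows "(\<Sum>k\<in>UNIV. G y $ l $ k * (\<Sum>m\<in>UNIV. H y k m * \<omega> m)) = \<omega> l"
proof -
  have "(\<Sum>k\<in>UNIV. G y $ l $ k * (\<Sum>m\<in>UNIV. H y k m * \<omega> m))
     = (\<Sum>m\<in>UNIV. (\<Sum>k\<in>UNIV. G y $ l $ k * H y k m) * \<omega> m)"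
    by (simp add: sum_distrib_left sum_distrib_right mult.assoc) (rule sum.swap)
  then show ?thesis by (simp add: metric_inverse[OF assms] sum_delta)
qed

lemma raise_lower:
  assumes "y \<in> U"
  shows "(\<Sum>k\<in>UNIV. H y l k * (\<Sum>m\<in>UNIV. G y $ k $ m * v m)) = v l"
proof -
  have "(\<Sum>k\<in>UNIV. H y l k * (\<Sum>m\<in>UNIV. G y $ k $ m * v m))
     = (\<Sum>m\<in>UNIV. (\<Sum>k\<in>UNIV. H y l k * G y $ k $ m) * v m)"
    by (simp add: sum_distrib_left sum_distrib_right mult.assoc) (rule sum.swap)
  then show ?thesis by (simp add: metric_inverse[OF assms] sum_delta)
qed

lemma partial_metric_sym:
  assumes "y \<in> U"
  shows "partial m (\<lambda>z. G z $ i $ j) y = partial m (\<lambda>z. G z $ j $ i) y"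
  by (rule partial_cong[OF open_domain assms]) (rule metric_sym)

lemma christoffel_sym:
  assumes "y \<in> U"
  shows "\<Gamma> k i j y = \<Gamma> k j i y"
  unfolding christoffel_def partial_metric_sym[OF assms, of _ i j] by (simp add: add.commute)

text \<open>This is \<open>\<nabla>g = 0\<close> in coordinates. Lowering the upper index of the Christoffel symbols leaves
  half of the combination of first derivatives that defines them, and in the sum of the two
  instances below all but the two copies of the derivative on the left cancel.\<close>

lemma metric_compatible:
  assumes "y \<in> U"
  shows "partial m (\<lambda>z. G z $ j $ k) y
    = (\<Sum>p\<in>UNIV. G y $ j $ p * \<Gamma> p m k y) + (\<Sum>p\<in>UNIV. G y $ k $ p * \<Gamma> p m j y)"
proof -
  have lower: "(\<Sum>p\<in>UNIV. G y $ l $ p * \<Gamma> p i j y)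
    = (1/2) * (partial i (\<lambda>z. G z $ j $ l) y + partial j (\<lambda>z. G z $ i $ l) y
        - partial l (\<lambda>z. G z $ i $ j) y)" (is "_ = (1/2) * ?\<omega> l") for l i j
  proof -
    have "(\<Sum>p\<in>UNIV. G y $ l $ p * \<Gamma> p i j y)
      = (\<Sum>p\<in>UNIV. (1/2) * (G y $ l $ p * (\<Sum>q\<in>UNIV. H y p q * ?\<omega> q)))"
      by (simp add: christoffel_def)
    also have "\<dots> = (1/2) * ?\<omega> l"
      unfolding sum_distrib_left[symmetric] lower_raise[OF assms] ..
    finally show ?thesis .
  qed
  show ?thesis
    unfolding lower partial_metric_sym[OF assms, of _ k j] partial_metric_sym[OF assms, of _ k m]
      partial_metric_sym[OF assms, of _ j m] by (simp add: field_simps)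
qed

lemma grad_lower:
  assumes "y \<in> U"
  shows "(\<Sum>k\<in>UNIV. G y $ l $ k * gradient G f y $ k) = partial l f y"
  by (simp add: gradient_def lower_raise[OF assms])

lemma grad_square_eq:
  assumes "y \<in> U"
  shows "grad_square G f y = (\<Sum>k\<in>UNIV. partial k f y * gradient G f y $ k)"
proof -
  have "grad_square G f y
    = (\<Sum>i\<in>UNIV. (\<Sum>j\<in>UNIV. G y $ i $ j * gradient G f y $ j) * gradient G f y $ i)"
    unfolding grad_square_def by (simp add: sum_distrib_left sum_distrib_right ac_simps)
  then show ?thesis by (simp add: grad_lower[OF assms])
qed

lemma gradient_differentiable:
  assumes "x \<in> U" "Ck_on 2 f U"
  shows "(\<lambda>y. gradient G f y $ k) differentiable (at x)"
  unfolding gradient_def vec_lambda_beta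
  by (intro differentiable_sum ballI differentiable_mult inverse_metric_differentiable
      C2_on_partial[OF assms(2)] assms(1)) auto

text \<open>The formula \<open>\<nabla>\<^sub>m (\<nabla>f)\<^sup>k = g\<^sup>k\<^sup>l (\<nabla>df)\<^sub>m\<^sub>l\<close>, obtained by differentiating
  \<open>df = g(\<nabla>f, \<cdot>)\<close> instead of the inverse matrix.\<close>

lemma partial_gradient:
  assumes x: "x \<in> U" and f: "Ck_on 2 f U"
  shows "partial m (\<lambda>y. gradient G f y $ k) x
    = (\<Sum>l\<in>UNIV. H x k l * hessian G f m l x)
      - (\<Sum>p\<in>UNIV. \<Gamma> k m p x * gradient G f x $ p)"
proof -
  define w where "w = (\<lambda>k y. gradient G f y $ k)"
  define v where "v k = partial m (w k) x + (\<Sum>p\<in>UNIV. \<Gamma> k m p x * w p x)" for k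
  have w: "w k differentiable (at x)" for k
    unfolding w_def by (rule gradient_differentiable[OF x f])
  have "(\<Sum>k\<in>UNIV. G x $ l $ k * v k) = hessian G f m l x" for l
  proof -
    have "partial m (partial l f) x = partial m (\<lambda>y. \<Sum>k\<in>UNIV. G y $ l $ k * w k y) x"
      by (rule partial_cong[OF open_domain x]) (simp add: w_def grad_lower)
    also have "\<dots> = (\<Sum>k\<in>UNIV. G x $ l $ k * partial m (w k) x
        + partial m (\<lambda>y. G y $ l $ k) x * w k x)"
      using w metric_differentiable[OF x] by (simp add: partial_sum partial_mult)
    also have "\<dots> = (\<Sum>k\<in>UNIV. G x $ l $ k * partial m (w k) x)
        + (\<Sum>k\<in>UNIV. (\<Sum>p\<in>UNIV. G x $ l $ p * \<Gamma> p m k x) * w k x)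
        + (\<Sum>k\<in>UNIV. (\<Sum>p\<in>UNIV. G x $ k $ p * \<Gamma> p m l x) * w k x)"
      unfolding metric_compatible[OF x] by (simp add: sum.distrib algebra_simps)
    also have "(\<Sum>k\<in>UNIV. (\<Sum>p\<in>UNIV. G x $ l $ p * \<Gamma> p m k x) * w k x)
        = (\<Sum>p\<in>UNIV. G x $ l $ p * (\<Sum>k\<in>UNIV. \<Gamma> p m k x * w k x))"
      by (simp add: sum_distrib_left sum_distrib_right mult.assoc) (rule sum.swap)
    also have "(\<Sum>k\<in>UNIV. (\<Sum>p\<in>UNIV. G x $ k $ p * \<Gamma> p m l x) * w k x)
        = (\<Sum>p\<in>UNIV. \<Gamma> p m l x * (\<Sum>k\<in>UNIV. G x $ p $ k * w k x))"
      unfolding sum_distrib_left sum_distrib_right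
      by (subst sum.swap) (simp add: metric_sym[OF x] ac_simps)
    also have "\<dots> = (\<Sum>p\<in>UNIV. \<Gamma> p m l x * partial p f x)"
      by (simp add: w_def grad_lower[OF x])
    finally show ?thesis
      by (simp add: hessian_def covariant_derivative_def v_def sum.distrib distrib_left)
  qed
  then have "v k = (\<Sum>l\<in>UNIV. H x k l * hessian G f m l x)"
    using raise_lower[OF x, of k v] by simp
  then show ?thesis
    by (simp add: v_def w_def)
qed

lemma divergence_gradient:
  assumes "x \<in> U" "Ck_on 2 f U"
  shows "(\<Sum>i\<in>UNIV. partial i (\<lambda>y. gradient G f y $ i) x)
    = laplacian G f x - (\<Sum>i\<in>UNIV. \<Sum>p\<in>UNIV. \<Gamma> i i p x * gradient G f x $ p)"
  unfolding partial_gradient[OF assms] laplacian_def sum_subtractf by simp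

end

section \<open>Conformal change of metric\<close>

text \<open>The factor is written as \<open>exp (- 2 * \<phi>)\<close> because then the transformation laws are polynomial in
  the derivatives of \<open>\<phi>\<close>; the factor \<open>1 / t\<^sup>2\<close> is the case \<open>\<phi> = ln \<bar>t\<bar>\<close>.\<close>

locale conformal_change = local_metric U G
  for U :: "(real ^ 'n::finite) set" and G +
  fixes \<phi> :: "real ^ 'n \<Rightarrow> real" and G' :: "real ^ 'n \<Rightarrow> real ^ 'n ^ 'n"
  assumes phi_C2: "Ck_on 2 \<phi> U"
    and conformal: "y \<in> U \<Longrightarrow> G' y = exp (- 2 * \<phi> y) *\<^sub>R G y"
begin

abbreviation d\<phi> :: "'n \<Rightarrow> real ^ 'n \<Rightarrow> real" where
  "d\<phi> j \<equiv> partial j \<phi>"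

abbreviation grad\<phi> :: "'n \<Rightarrow> real ^ 'n \<Rightarrow> real" where
  "grad\<phi> k y \<equiv> gradient G \<phi> y $ k"

text \<open>The difference of the two Levi-Civita connections, a tensor that is symmetric in its lower
  indices: \<open>g\<^sub>i\<^sub>j \<nabla>\<^sup>k\<phi> - \<delta>\<^sup>k\<^sub>i \<partial>\<^sub>j\<phi> - \<delta>\<^sup>k\<^sub>j \<partial>\<^sub>i\<phi>\<close>. The Kronecker symbol is written as an entry of
  \<open>mat 1\<close>.\<close>

definition \<Delta>\<Gamma> :: "'n \<Rightarrow> 'n \<Rightarrow> 'n \<Rightarrow> real ^ 'n \<Rightarrow> real" where
  "\<Delta>\<Gamma> k i j y = G y $ i $ j * grad\<phi> k y - mat 1 $ k $ i * d\<phi> j y - mat 1 $ k $ j * d\<phi> i y"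

lemma phi_differentiable:
  assumes "x \<in> U"
  shows "\<phi> differentiable (at x)" "d\<phi> j differentiable (at x)" "grad\<phi> k differentiable (at x)"
  using C2_on_partial[OF phi_C2 assms] gradient_differentiable[OF assms phi_C2] by auto

lemma partial_conformal:
  assumes "y \<in> U"
  shows "partial m (\<lambda>z. G' z $ i $ j) y
    = exp (- 2 * \<phi> y) * (partial m (\<lambda>z. G z $ i $ j) y - 2 * d\<phi> m y * G y $ i $ j)"
proof -
  have "((\<lambda>t. exp (- 2 * t)) has_real_derivative - 2 * exp (- 2 * \<phi> y)) (at (\<phi> y))"
    by (auto intro!: derivative_eq_intros)
  note chain = partial_chain[OF phi_differentiable(1)[OF assms] this]
  have "(\<lambda>y. exp (- 2 * \<phi> y)) differentiable (at y)"
    using differentiable_compose[of exp "\<lambda>y. - 2 * \<phi> y" y UNIV] phi_differentiable(1)[OF assms]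
    by (auto simp: field_differentiable_imp_differentiable field_differentiable_within_exp)
  then have "partial m (\<lambda>z. exp (- 2 * \<phi> z) * G z $ i $ j) y
    = exp (- 2 * \<phi> y) * (partial m (\<lambda>z. G z $ i $ j) y - 2 * d\<phi> m y * G y $ i $ j)"
    using metric_differentiable[OF assms] chain by (simp add: partial_mult algebra_simps)
  moreover have "partial m (\<lambda>z. G' z $ i $ j) y = partial m (\<lambda>z. exp (- 2 * \<phi> z) * G z $ i $ j) y"
    by (rule partial_cong[OF open_domain assms]) (simp add: conformal)
  ultimately show ?thesis by simp
qed

lemma christoffel_conformal:
  assumes "y \<in> U"
  shows "christoffel G' k i j y = \<Gamma> k i j y + \<Delta>\<Gamma> k i j y"
proof -
  let ?d = "\<lambda>l. partial i (\<lambda>z. G z $ j $ l) y + partial j (\<lambda>z. G z $ i $ l) y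
    - partial l (\<lambda>z. G z $ i $ j) y"
  have inv: "matrix_inv (G' y) $ k $ l = exp (2 * \<phi> y) * H y k l" for l
    by (simp add: conformal[OF assms] matrix_inv_scaleR[OF metric_invertible[OF assms]]
        flip: exp_minus)
  have "christoffel G' k i j y = (1/2) * (\<Sum>l\<in>UNIV. exp (2 * \<phi> y) * H y k l *
      (exp (- 2 * \<phi> y) * (?d l - 2 * d\<phi> i y * G y $ j $ l - 2 * d\<phi> j y * G y $ i $ l
         + 2 * d\<phi> l y * G y $ i $ j)))"
    unfolding christoffel_def inv partial_conformal[OF assms] by (simp add: algebra_simps)
  also have "\<dots> = (1/2) * (\<Sum>l\<in>UNIV. H y k l * (?d l - 2 * d\<phi> i y * G y $ j $ l
      - 2 * d\<phi> j y * G y $ i $ l + 2 * d\<phi> l y * G y $ i $ j))"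
  proof -
    have cancel: "exp (2 * \<phi> y) * a * (exp (- 2 * \<phi> y) * b) = a * b" for a b
      by (simp add: exp_minus)
    show ?thesis
      unfolding cancel ..
  qed
  also have "\<dots> = \<Gamma> k i j y - d\<phi> i y * (\<Sum>l\<in>UNIV. H y k l * G y $ j $ l)
      - d\<phi> j y * (\<Sum>l\<in>UNIV. H y k l * G y $ i $ l) + G y $ i $ j * (\<Sum>l\<in>UNIV. H y k l * d\<phi> l y)"
    unfolding christoffel_def
    by (simp add: sum_distrib_left algebra_simps sum.distrib sum_subtractf)
  finally have expanded: "christoffel G' k i j y = \<dots>" .
  have "(\<Sum>l\<in>UNIV. H y k l * G y $ p $ l) = mat 1 $ k $ p" for p
    using metric_inverse(2)[OF assms, of k p] by (simp add: metric_sym[OF assms, of p])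
  then show ?thesis
    using expanded by (simp add: \<Delta>\<Gamma>_def gradient_def)
qed

lemma hessian_conformal:
  assumes "y \<in> U"
  shows "hessian G' f i j y = hessian G f i j y + d\<phi> i y * partial j f y + d\<phi> j y * partial i f y
    - G y $ i $ j * (\<Sum>k\<in>UNIV. grad\<phi> k y * partial k f y)"
proof -
  have "(\<Sum>k\<in>UNIV. \<Delta>\<Gamma> k i j y * partial k f y)
    = G y $ i $ j * (\<Sum>k\<in>UNIV. grad\<phi> k y * partial k f y)
      - (\<Sum>k\<in>UNIV. mat 1 $ k $ i * (d\<phi> j y * partial k f y))
      - (\<Sum>k\<in>UNIV. mat 1 $ k $ j * (d\<phi> i y * partial k f y))"
    by (simp add: \<Delta>\<Gamma>_def algebra_simps sum.distrib sum_subtractf sum_distrib_left)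
  then show ?thesis
    unfolding hessian_def covariant_derivative_def christoffel_conformal[OF assms]
    by (simp add: distrib_right sum.distrib sum_delta)
qed

text \<open>Contractions of the difference tensor against an arbitrary covector or vector. The
  double sums in the transformation of the Ricci tensor reduce to these and to the trace.\<close>

lemma christoffel_difference_contract_upper:
  "(\<Sum>m\<in>UNIV. a m * \<Delta>\<Gamma> m i j y)
   = G y $ i $ j * (\<Sum>m\<in>UNIV. a m * grad\<phi> m y) - a i * d\<phi> j y - a j * d\<phi> i y"
proof -
  have "(\<Sum>m\<in>UNIV. a m * \<Delta>\<Gamma> m i j y) = G y $ i $ j * (\<Sum>m\<in>UNIV. a m * grad\<phi> m y)
      - (\<Sum>m\<in>UNIV. mat 1 $ m $ i * (a m * d\<phi> j y)) - (\<Sum>m\<in>UNIV. mat 1 $ m $ j * (a m * d\<phi> i y))"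
    by (simp add: \<Delta>\<Gamma>_def algebra_simps sum.distrib sum_subtractf sum_distrib_left)
  then show ?thesis by (simp add: sum_delta)
qed

lemma christoffel_difference_contract_lower:
  "(\<Sum>m\<in>UNIV. \<Delta>\<Gamma> k i m y * a m)
   = grad\<phi> k y * (\<Sum>m\<in>UNIV. G y $ i $ m * a m) - mat 1 $ k $ i * (\<Sum>m\<in>UNIV. d\<phi> m y * a m) - a k * d\<phi> i y"
proof -
  have "(\<Sum>m\<in>UNIV. \<Delta>\<Gamma> k i m y * a m) = grad\<phi> k y * (\<Sum>m\<in>UNIV. G y $ i $ m * a m)
      - mat 1 $ k $ i * (\<Sum>m\<in>UNIV. d\<phi> m y * a m) - (\<Sum>m\<in>UNIV. mat 1 $ k $ m * (a m * d\<phi> i y))"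
    by (simp add: \<Delta>\<Gamma>_def algebra_simps sum.distrib sum_subtractf sum_distrib_left)
  then show ?thesis by (simp add: sum_delta)
qed

lemma christoffel_difference_trace:
  assumes "y \<in> U"
  shows "(\<Sum>i\<in>UNIV. \<Delta>\<Gamma> i i k y) = - real CARD('n) * d\<phi> k y"
proof -
  have "(\<Sum>i\<in>UNIV. \<Delta>\<Gamma> i i k y) = (\<Sum>i\<in>UNIV. G y $ k $ i * grad\<phi> i y)
      - real CARD('n) * d\<phi> k y - (\<Sum>i\<in>UNIV. mat 1 $ i $ k * d\<phi> i y)"
    by (simp add: \<Delta>\<Gamma>_def sum_subtractf metric_sym[OF assms, of _ k] mat_def)
  then show ?thesis by (simp add: sum_delta grad_lower[OF assms])
qed

lemma christoffel_difference_differentiable: "x \<in> U \<Longrightarrow> \<Delta>\<Gamma> k i j differentiable (at x)"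
  unfolding \<Delta>\<Gamma>_def[abs_def]
  by (intro differentiable_diff differentiable_mult metric_differentiable phi_differentiable
      differentiable_const)

lemma christoffel_difference_divergence:
  assumes x: "x \<in> U"
  shows "(\<Sum>i\<in>UNIV. partial i (\<Delta>\<Gamma> i j k) x)
    = G x $ j $ k * (\<Sum>i\<in>UNIV. partial i (grad\<phi> i) x)
      + (\<Sum>i\<in>UNIV. partial i (\<lambda>y. G y $ j $ k) x * grad\<phi> i x) - partial j (d\<phi> k) x - partial k (d\<phi> j) x"
proof -
  note d = metric_differentiable[OF x] phi_differentiable[OF x]
  have "partial i (\<Delta>\<Gamma> i j k) x = G x $ j $ k * partial i (grad\<phi> i) x
    + partial i (\<lambda>y. G y $ j $ k) x * grad\<phi> i x
    - mat 1 $ i $ j * partial i (d\<phi> k) x - mat 1 $ i $ k * partial i (d\<phi> j) x" for i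
    unfolding \<Delta>\<Gamma>_def[abs_def]
    by (simp add: d partial_diff partial_mult)
  then show ?thesis
    by (simp add: sum.distrib sum_subtractf sum_delta sum_distrib_left)
qed

lemma christoffel_difference_square:
  assumes x: "x \<in> U"
  shows "(\<Sum>i\<in>UNIV. \<Sum>m\<in>UNIV. \<Delta>\<Gamma> i j m x * \<Delta>\<Gamma> m i k x)
    = (real CARD('n) + 2) * (d\<phi> j x * d\<phi> k x) - 2 * grad_square G \<phi> x * G x $ j $ k"
proof -
  define q where "q = (\<Sum>m\<in>UNIV. d\<phi> m x * grad\<phi> m x)"
  have lower: "(\<Sum>m\<in>UNIV. G x $ i $ m * grad\<phi> m x) = d\<phi> i x" for i
    by (rule grad_lower[OF x])
  have inner: "(\<Sum>m\<in>UNIV. \<Delta>\<Gamma> i j m x * \<Delta>\<Gamma> m i k x)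
    = grad\<phi> i x * (G x $ i $ k * d\<phi> j x - G x $ j $ i * d\<phi> k x - G x $ j $ k * d\<phi> i x)
      - mat 1 $ i $ j * (G x $ i $ k * q - 2 * (d\<phi> i x * d\<phi> k x)) - \<Delta>\<Gamma> i i k x * d\<phi> j x" for i
    by (simp add: christoffel_difference_contract_lower christoffel_difference_contract_upper lower q_def)
  have "(\<Sum>i\<in>UNIV. \<Sum>m\<in>UNIV. \<Delta>\<Gamma> i j m x * \<Delta>\<Gamma> m i k x)
    = d\<phi> j x * (\<Sum>i\<in>UNIV. G x $ k $ i * grad\<phi> i x) - d\<phi> k x * (\<Sum>i\<in>UNIV. G x $ j $ i * grad\<phi> i x)
      - G x $ j $ k * q - (\<Sum>i\<in>UNIV. mat 1 $ i $ j * (G x $ i $ k * q - 2 * (d\<phi> i x * d\<phi> k x)))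
      - (\<Sum>i\<in>UNIV. \<Delta>\<Gamma> i i k x) * d\<phi> j x"
    unfolding inner metric_sym[OF x, of _ k] q_def
    by (simp add: sum.distrib sum_subtractf sum_distrib_left sum_distrib_right algebra_simps)
  then show ?thesis
    unfolding sum_delta lower christoffel_difference_trace[OF x] grad_square_eq[OF x] q_def[symmetric]
    by (simp add: algebra_simps)
qed

text \<open>The Ricci tensor is linear in the first derivatives and quadratic in the values of the
  Christoffel symbols, so inserting \<open>\<Gamma> + \<Delta>\<Gamma>\<close> leaves the divergence and the trace of \<open>\<Delta>\<Gamma>\<close>, mixed
  products, and products of \<open>\<Delta>\<Gamma>\<close> with itself.\<close>

lemma ricci_difference:
  assumes x: "x \<in> U"
  shows "ricci G' j k x = ricci G j k x
    + (\<Sum>i\<in>UNIV. partial i (\<Delta>\<Gamma> i j k) x) - (\<Sum>i\<in>UNIV. partial j (\<Delta>\<Gamma> i i k) x)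
    + (\<Sum>i\<in>UNIV. \<Sum>m\<in>UNIV. \<Gamma> i i m x * \<Delta>\<Gamma> m j k x) + (\<Sum>i\<in>UNIV. \<Sum>m\<in>UNIV. \<Delta>\<Gamma> i i m x * \<Gamma> m j k x)
    + (\<Sum>i\<in>UNIV. \<Sum>m\<in>UNIV. \<Delta>\<Gamma> i i m x * \<Delta>\<Gamma> m j k x)
    - (\<Sum>i\<in>UNIV. \<Sum>m\<in>UNIV. \<Gamma> i j m x * \<Delta>\<Gamma> m i k x) - (\<Sum>i\<in>UNIV. \<Sum>m\<in>UNIV. \<Delta>\<Gamma> i j m x * \<Gamma> m i k x)
    - (\<Sum>i\<in>UNIV. \<Sum>m\<in>UNIV. \<Delta>\<Gamma> i j m x * \<Delta>\<Gamma> m i k x)"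
proof -
  have "partial a (christoffel G' l p r) x = partial a (\<Gamma> l p r) x + partial a (\<Delta>\<Gamma> l p r) x" for a l p r
  proof -
    have "partial a (christoffel G' l p r) x = partial a (\<lambda>y. \<Gamma> l p r y + \<Delta>\<Gamma> l p r y) x"
      by (rule partial_cong[OF open_domain x]) (rule christoffel_conformal)
    then show ?thesis
      by (simp add: partial_add christoffel_differentiable[OF x] christoffel_difference_differentiable[OF x])
  qed
  then show ?thesis
    unfolding ricci_def riemann_def
    by (simp add: christoffel_conformal[OF x] sum.distrib sum_subtractf algebra_simps)
qed

text \<open>The classical transformation law. Differentiating the term \<open>g\<^sub>j\<^sub>k \<nabla>\<^sup>i\<phi>\<close> of \<open>\<Delta>\<Gamma>\<close> produces a derivative of
  the metric, which by \<open>\<nabla>g = 0\<close> is the sum of the expressions \<open>P\<close> and \<open>R\<close> below; both cancel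
  against mixed products of \<open>\<Gamma>\<close> and \<open>\<Delta>\<Gamma>\<close>. The remaining mixed products turn the second derivatives
  of \<open>\<phi>\<close> into its covariant Hessian and Laplacian.\<close>

lemma ricci_conformal:
  assumes x: "x \<in> U"
  shows "ricci G' j k x = ricci G j k x
    + (real CARD('n) - 2) * (hessian G \<phi> j k x + d\<phi> j x * d\<phi> k x)
    + (laplacian G \<phi> x - (real CARD('n) - 2) * grad_square G \<phi> x) * G x $ j $ k"
proof -
  define n where "n = real CARD('n)"
  define q where "q = grad_square G \<phi> x"
  define \<Gamma>c where "\<Gamma>c = (\<Sum>m\<in>UNIV. \<Gamma> m j k x * d\<phi> m x)"
  define g where "g = G x $ j $ k"
  define tr where "tr m = (\<Sum>i\<in>UNIV. \<Gamma> i i m x)" for m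
  define trw where "trw = (\<Sum>i\<in>UNIV. \<Sum>m\<in>UNIV. \<Gamma> i i m x * grad\<phi> m x)"
  define P where "P = (\<Sum>i\<in>UNIV. \<Sum>m\<in>UNIV. \<Gamma> i j m x * G x $ i $ k * grad\<phi> m x)"
  define R where "R = (\<Sum>i\<in>UNIV. \<Sum>m\<in>UNIV. G x $ j $ m * \<Gamma> m i k x * grad\<phi> i x)"
  have div: "(\<Sum>i\<in>UNIV. partial i (\<Delta>\<Gamma> i j k) x)
    = g * (laplacian G \<phi> x - trw) + (P + R) - partial j (d\<phi> k) x - partial j (d\<phi> k) x"
  proof -
    have "(\<Sum>i\<in>UNIV. partial i (\<lambda>y. G y $ j $ k) x * grad\<phi> i x)
       = R + (\<Sum>i\<in>UNIV. \<Sum>m\<in>UNIV. G x $ k $ m * \<Gamma> m i j x * grad\<phi> i x)"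
      unfolding metric_compatible[OF x] R_def
      by (simp add: distrib_right sum.distrib sum_distrib_right)
    also have "(\<Sum>i\<in>UNIV. \<Sum>m\<in>UNIV. G x $ k $ m * \<Gamma> m i j x * grad\<phi> i x) = P"
      unfolding P_def
      by (subst sum.swap) (simp add: metric_sym[OF x, of k] christoffel_sym[OF x, of _ _ j] ac_simps)
    finally show ?thesis
      unfolding christoffel_difference_divergence[OF x] divergence_gradient[OF x phi_C2] g_def trw_def
        partial_commute[OF open_domain x phi_C2, of k j] by simp
  qed
  \<comment> \<open>The trace is \<open>- n d\<phi>\<close> on all of \<open>U\<close>, so its derivative needs no product rule.\<close>
  have dtr: "(\<Sum>i\<in>UNIV. partial j (\<Delta>\<Gamma> i i k) x) = - n * partial j (d\<phi> k) x"
  proof -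
    have "(\<Sum>i\<in>UNIV. partial j (\<Delta>\<Gamma> i i k) x) = partial j (\<lambda>y. \<Sum>i\<in>UNIV. \<Delta>\<Gamma> i i k y) x"
      by (rule partial_sum[symmetric]) (rule christoffel_difference_differentiable[OF x])
    also have "\<dots> = partial j (\<lambda>y. - n * d\<phi> k y) x"
      by (rule partial_cong[OF open_domain x]) (simp add: christoffel_difference_trace n_def)
    also have "\<dots> = - n * partial j (d\<phi> k) x"
      by (rule partial_cmult) (rule phi_differentiable[OF x])
    finally show ?thesis .
  qed
  have A1: "(\<Sum>i\<in>UNIV. \<Sum>m\<in>UNIV. \<Gamma> i i m x * \<Delta>\<Gamma> m j k x) = g * trw - tr j * d\<phi> k x - tr k * d\<phi> j x"
    by (simp add: christoffel_difference_contract_upper sum_subtractf g_def trw_def tr_def sum_distrib_left sum_distrib_right)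
  have trace_first: "(\<Sum>i\<in>UNIV. \<Sum>m\<in>UNIV. \<Delta>\<Gamma> i i m x * a m) = - n * (\<Sum>m\<in>UNIV. d\<phi> m x * a m)" for a
  proof -
    have "(\<Sum>i\<in>UNIV. \<Sum>m\<in>UNIV. \<Delta>\<Gamma> i i m x * a m) = (\<Sum>m\<in>UNIV. (\<Sum>i\<in>UNIV. \<Delta>\<Gamma> i i m x) * a m)"
      unfolding sum_distrib_right by (rule sum.swap)
    then show ?thesis
      by (simp add: christoffel_difference_trace[OF x] n_def sum_distrib_left sum_negf mult.assoc)
  qed
  have A2: "(\<Sum>i\<in>UNIV. \<Sum>m\<in>UNIV. \<Delta>\<Gamma> i i m x * \<Gamma> m j k x) = - n * \<Gamma>c"
    unfolding trace_first \<Gamma>c_def by (simp add: mult.commute)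
  have A3: "(\<Sum>i\<in>UNIV. \<Sum>m\<in>UNIV. \<Delta>\<Gamma> i i m x * \<Delta>\<Gamma> m j k x) = - n * (g * q - 2 * (d\<phi> j x * d\<phi> k x))"
    unfolding trace_first unfolding christoffel_difference_contract_upper by (simp add: q_def g_def grad_square_eq[OF x])
  have A4: "(\<Sum>i\<in>UNIV. \<Sum>m\<in>UNIV. \<Gamma> i j m x * \<Delta>\<Gamma> m i k x) = P - tr j * d\<phi> k x - \<Gamma>c"
  proof -
    have "(\<Sum>i\<in>UNIV. \<Gamma> i j i x * d\<phi> k x) = tr j * d\<phi> k x"
      by (simp add: tr_def sum_distrib_right christoffel_sym[OF x, of _ j])
    then show ?thesis
      by (simp add: christoffel_difference_contract_upper sum_subtractf P_def \<Gamma>c_def sum_distrib_left ac_simps)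
  qed
  have A5: "(\<Sum>i\<in>UNIV. \<Sum>m\<in>UNIV. \<Delta>\<Gamma> i j m x * \<Gamma> m i k x) = R - \<Gamma>c - tr k * d\<phi> j x"
  proof -
    have contract: "(\<Sum>i\<in>UNIV. mat 1 $ i $ j * (\<Sum>m\<in>UNIV. d\<phi> m x * \<Gamma> m i k x)) = \<Gamma>c"
      by (simp add: sum_delta \<Gamma>c_def mult.commute)
    show ?thesis
      unfolding christoffel_difference_contract_lower sum_subtractf contract
      by (simp add: R_def tr_def sum_distrib_left sum_distrib_right ac_simps)
  qed
  have "ricci G' j k x = ricci G j k x + (n - 2) * (partial j (d\<phi> k) x - \<Gamma>c + d\<phi> j x * d\<phi> k x)
    + (laplacian G \<phi> x - (n - 2) * q) * g"
    unfolding ricci_difference[OF x] div dtr A1 A2 A3 A4 A5 christoffel_difference_square[OF x]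
    unfolding n_def[symmetric] q_def[symmetric] g_def[symmetric]
    by (simp add: algebra_simps)
  then show ?thesis
    by (simp add: hessian_def covariant_derivative_def n_def q_def g_def \<Gamma>c_def)
qed

end

section \<open>The conformal factor \<open>1 / t\<^sup>2\<close>\<close>

context local_metric
begin

lemma partial_compose:
  assumes "y \<in> U" "Ck_on 2 t U" "(h has_real_derivative d) (at (t y))"
  shows "partial j (\<lambda>z. h (t z)) y = d * partial j t y"
  using C2_on_partial(1)[OF assms(2,1)] assms(3) by (rule partial_chain)

lemma hessian_compose:
  assumes x: "x \<in> U" and t: "Ck_on 2 t U"
    and h: "\<And>y. y \<in> U \<Longrightarrow> (h has_real_derivative h' (t y)) (at (t y))"
    and h': "(h' has_real_derivative d) (at (t x))"
  shows "hessian G (\<lambda>y. h (t y)) i j x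
    = h' (t x) * hessian G t i j x + d * (partial i t x * partial j t x)"
proof -
  have h't: "(\<lambda>y. h' (t y)) differentiable (at x)"
    using differentiable_chain_at[OF C2_on_partial(1)[OF t x], of h'] h'
    by (auto simp: o_def real_differentiable_def)
  have "partial i (partial j (\<lambda>y. h (t y))) x = partial i (\<lambda>y. h' (t y) * partial j t y) x"
    by (rule partial_cong[OF open_domain x]) (rule partial_compose[OF _ t h])
  also have "\<dots> = h' (t x) * partial i (partial j t) x + d * partial i t x * partial j t x"
    using partial_mult[OF h't C2_on_partial(2)[OF t x]] partial_compose[OF x t h'] by simp
  finally show ?thesis
    using partial_compose[OF x t h[OF x]]
    by (simp add: hessian_def covariant_derivative_def algebra_simps sum_distrib_left)
qed

lemma gradient_compose:
  assumes "x \<in> U" "Ck_on 2 t U" "(h has_real_derivative d) (at (t x))"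
  shows "gradient G (\<lambda>y. h (t y)) x $ k = d * gradient G t x $ k"
  using partial_compose[OF assms] by (simp add: gradient_def sum_distrib_left mult.left_commute)

lemma laplacian_compose:
  assumes x: "x \<in> U" and t: "Ck_on 2 t U"
    and h: "\<And>y. y \<in> U \<Longrightarrow> (h has_real_derivative h' (t y)) (at (t y))"
    and h': "(h' has_real_derivative d) (at (t x))"
  shows "laplacian G (\<lambda>y. h (t y)) x = h' (t x) * laplacian G t x + d * grad_square G t x"
proof -
  have "grad_square G t x = (\<Sum>i\<in>UNIV. \<Sum>j\<in>UNIV. H x i j * (partial i t x * partial j t x))"
    by (simp add: grad_square_eq[OF x] gradient_def sum_distrib_left mult.left_commute)
  moreover have "hessian G (\<lambda>y. h (t y)) i j x
      = h' (t x) * hessian G t i j x + d * (partial i t x * partial j t x)" for i j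
    by (rule hessian_compose[OF x t h h'])
  ultimately show ?thesis
    by (simp add: laplacian_def algebra_simps sum.distrib sum_distrib_left)
qed

lemma grad_square_compose:
  assumes "x \<in> U" "Ck_on 2 t U" "(h has_real_derivative d) (at (t x))"
  shows "grad_square G (\<lambda>y. h (t y)) x = d\<^sup>2 * grad_square G t x"
  using gradient_compose[OF assms]
  by (simp add: grad_square_def sum_distrib_left power2_eq_square ac_simps)

context
  fixes t :: "real ^ 'n \<Rightarrow> real" and G' :: "real ^ 'n \<Rightarrow> real ^ 'n ^ 'n"
  assumes t: "Ck_on 2 t U" and nz: "\<And>y. y \<in> U \<Longrightarrow> t y \<noteq> 0"
    and G': "\<And>y. y \<in> U \<Longrightarrow> G' y = (1 / (t y)\<^sup>2) *\<^sub>R G y"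
begin

interpretation conformal_change U G "\<lambda>y. ln \<bar>t y\<bar>" G'
proof
  show "Ck_on 2 (\<lambda>y. ln \<bar>t y\<bar>) U"
    by (rule Ck_on_ln_abs[OF open_domain t nz])
  show "G' y = exp (- 2 * ln \<bar>t y\<bar>) *\<^sub>R G y" if "y \<in> U" for y
  proof -
    have "exp (- 2 * ln \<bar>t y\<bar>) = inverse (exp (ln \<bar>t y\<bar>) ^ 2)"
      by (simp add: exp_minus exp_double)
    also have "\<dots> = 1 / (t y)\<^sup>2"
      using nz[OF that] by (simp add: divide_inverse)
    finally show ?thesis
      using G'[OF that] by simp
  qed
qed

lemma partial_log_factor: "y \<in> U \<Longrightarrow> partial j (\<lambda>y. ln \<bar>t y\<bar>) y = partial j t y / t y"
  using partial_compose[OF _ t DERIV_ln_abs[OF nz]] by (simp add: divide_inverse mult.commute)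

text \<open>Passing from \<open>\<phi> = ln \<bar>t\<bar>\<close> to \<open>t\<close> itself: the term \<open>dt \<otimes> dt\<close> of the Hessian of the logarithm
  cancels the term \<open>d\<phi> \<otimes> d\<phi>\<close> of the transformation law.\<close>

lemma ricci_divided_by_square:
  assumes x: "x \<in> U"
  shows "ricci G' i j x = ricci G i j x + (real CARD('n) - 2) / t x * hessian G t i j x
    + (laplacian G t x / t x - (real CARD('n) - 1) * grad_square G t x / (t x)\<^sup>2) * G x $ i $ j"
proof -
  have d: "((\<lambda>y. ln \<bar>y\<bar>) has_real_derivative inverse (t y)) (at (t y))" if "y \<in> U" for y
    by (rule DERIV_ln_abs[OF nz[OF that]])
  have d2: "(inverse has_real_derivative - (1 / (t x)\<^sup>2)) (at (t x))"
    using nz[OF x] by (auto intro!: derivative_eq_intros simp: power2_eq_square divide_inverse)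
  have hess: "hessian G (\<lambda>y. ln \<bar>t y\<bar>) i j x
    = inverse (t x) * hessian G t i j x + - (1 / (t x)\<^sup>2) * (partial i t x * partial j t x)"
    by (rule hessian_compose[OF x t d d2])
  have lap: "laplacian G (\<lambda>y. ln \<bar>t y\<bar>) x
    = inverse (t x) * laplacian G t x + - (1 / (t x)\<^sup>2) * grad_square G t x"
    by (rule laplacian_compose[OF x t d d2])
  show ?thesis
    unfolding ricci_conformal[OF x] hess lap partial_log_factor[OF x]
      grad_square_compose[OF x t d[OF x]]
    using nz[OF x] by (simp add: field_simps power2_eq_square)
qed

text \<open>Here \<open>1 / t\<close> is the function for which the terms \<open>dt \<otimes> dt\<close> cancel, so that its new Hessian is a
  combination of the old Hessian of \<open>t\<close> and the metric.\<close>

lemma hessian_divided_by_square: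
  assumes x: "x \<in> U"
  shows "hessian G' (\<lambda>y. 1 / t y) i j x
    = grad_square G t x / (t x) ^ 3 * G x $ i $ j - hessian G t i j x / (t x)\<^sup>2"
proof -
  have d: "((\<lambda>s. 1 / s) has_real_derivative (\<lambda>s. - (1 / s\<^sup>2)) (t y)) (at (t y))" if "y \<in> U" for y
    using nz[OF that] by (auto intro!: derivative_eq_intros simp: power2_eq_square)
  have d2: "((\<lambda>s. - (1 / s\<^sup>2)) has_real_derivative 2 / (t x) ^ 3) (at (t x))"
    using nz[OF x]
    by (auto intro!: derivative_eq_intros simp: power2_eq_square power3_eq_cube field_simps)
  have hess: "hessian G (\<lambda>y. 1 / t y) i j x
    = - (1 / (t x)\<^sup>2) * hessian G t i j x + 2 / (t x) ^ 3 * (partial i t x * partial j t x)"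
    by (rule hessian_compose[OF x t d d2])
  have df: "partial k (\<lambda>y. 1 / t y) x = - (1 / (t x)\<^sup>2) * partial k t x" for k
    by (rule partial_compose[OF x t d[OF x]])
  have inner: "(\<Sum>k\<in>UNIV. gradient G (\<lambda>y. ln \<bar>t y\<bar>) x $ k * (- (1 / (t x)\<^sup>2) * partial k t x))
    = - (grad_square G t x / (t x) ^ 3)"
    unfolding gradient_compose[OF x t DERIV_ln_abs[OF nz[OF x]]] grad_square_eq[OF x]
    using nz[OF x]
    by (simp add: sum_negf sum_divide_distrib divide_inverse power2_eq_square power3_eq_cube
        sum_distrib_left sum_distrib_right ac_simps)
  show ?thesis
    unfolding hessian_conformal[OF x] hess partial_log_factor[OF x] df inner
    using nz[OF x] by (simp add: field_simps power2_eq_square power3_eq_cube)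
qed

text \<open>The coefficient of the new Hessian is forced by matching the Hessians of \<open>t\<close>: the Ricci tensor
  contributes \<open>(n - 2) / t\<close> and the hypothesis \<open>- a\<close>, while the new Hessian carries \<open>- 1 / t\<^sup>2\<close>.\<close>

lemma hessian_ricci_equation_divided_by_square:
  assumes x: "x \<in> U" and eq: "a * hessian G t i j x + ricci G i j x = b * G x $ i $ j"
  shows "((real CARD('n) - 2) * t x - (t x)\<^sup>2 * a) * hessian G' (\<lambda>y. 1 / t y) i j x + ricci G' i j x
    = (b * (t x)\<^sup>2 - (1 + a * t x) * grad_square G t x + t x * laplacian G t x) * G' x $ i $ j"
proof -
  have ric: "ricci G i j x = b * G x $ i $ j - a * hessian G t i j x"
    using eq by simp
  show ?thesis
    unfolding ricci_divided_by_square[OF x] hessian_divided_by_square[OF x] G'[OF x] ric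
    using nz[OF x] by (simp add: field_simps power2_eq_square power3_eq_cube)
qed

end

end


section \<open>Locality of the coordinate expressions\<close>

context
  fixes U :: "(real ^ 'n::finite) set" and G1 G2 :: "real ^ 'n \<Rightarrow> real ^ 'n ^ 'n"
  assumes U: "open U" and G: "\<And>y. y \<in> U \<Longrightarrow> G1 y = G2 y"
begin

lemma christoffel_cong: "x \<in> U \<Longrightarrow> christoffel G1 k i j x = christoffel G2 k i j x"
proof -
  assume x: "x \<in> U"
  have "partial m (\<lambda>y. G1 y $ a $ b) x = partial m (\<lambda>y. G2 y $ a $ b) x" for m a b
    by (rule partial_cong[OF U x]) (simp add: G)
  then show ?thesis
    by (simp add: christoffel_def G[OF x])
qed

context
  fixes f1 f2 :: "real ^ 'n \<Rightarrow> real"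
  assumes f: "\<And>y. y \<in> U \<Longrightarrow> f1 y = f2 y"
begin

lemma hessian_cong: "x \<in> U \<Longrightarrow> hessian G1 f1 i j x = hessian G2 f2 i j x"
proof -
  assume x: "x \<in> U"
  have p: "y \<in> U \<Longrightarrow> partial k f1 y = partial k f2 y" for k y
    by (rule partial_cong[OF U _ f])
  have "partial i (partial j f1) x = partial i (partial j f2) x"
    by (rule partial_cong[OF U x p])
  then show ?thesis
    by (simp add: hessian_def covariant_derivative_def christoffel_cong[OF x] p[OF x])
qed

lemma laplacian_cong: "x \<in> U \<Longrightarrow> laplacian G1 f1 x = laplacian G2 f2 x"
  by (simp add: laplacian_def hessian_cong G)

lemma grad_square_cong: "x \<in> U \<Longrightarrow> grad_square G1 f1 x = grad_square G2 f2 x"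
proof -
  assume x: "x \<in> U"
  have "partial k f1 x = partial k f2 x" for k
    by (rule partial_cong[OF U x f])
  then show ?thesis
    by (simp add: grad_square_def gradient_def G[OF x])
qed

end

end

section \<open>Charts\<close>

lemma smooth_on_imp_C2: "smooth_on f U \<Longrightarrow> Ck_on 2 f U"
  by (simp add: smooth_on_def)

lemma in_chart_apply:
  assumes "inj_on (snd c) (fst c)" "p \<in> fst c"
  shows "in_chart c f (snd c p) = f p"
  using assms by (simp add: in_chart_def)

context
  fixes X :: "'a topology" and c :: "('a, 'n::finite) chart"
  assumes chart: "topological_chart X c"
begin

lemma chart_domain_open: "openin X (fst c)"
  using chart by (simp add: topological_chart_def)

lemma chart_topspace: "topspace (subtopology X (fst c)) = fst c"
  using openin_subset[OF chart_domain_open] by auto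

lemma chart_homeomorphic:
  "homeomorphic_map (subtopology X (fst c)) (top_of_set (chart_image c)) (snd c)"
  using chart by (simp add: topological_chart_def)

lemma chart_inj: "inj_on (snd c) (fst c)"
  using homeomorphic_imp_injective_map[OF chart_homeomorphic] unfolding chart_topspace .

lemma chart_open_image:
  assumes "openin X W"
  shows "open (snd c ` (fst c \<inter> W))"
proof -
  have "openin (subtopology X (fst c)) (fst c \<inter> W)"
    using assms by (rule openin_subtopology_Int2)
  then have "openin (top_of_set (chart_image c)) (snd c ` (fst c \<inter> W))"
    using homeomorphic_imp_open_map[OF chart_homeomorphic] by (simp add: open_map_def)
  moreover have "open (chart_image c)"
    using chart by (simp add: topological_chart_def)
  ultimately show ?thesis
    using openin_open_eq by blast
qed

lemma chart_open_preimage: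
  assumes "open V"
  shows "openin X {q \<in> fst c. snd c q \<in> V}"
proof -
  have "openin (top_of_set (chart_image c)) (chart_image c \<inter> V)"
    using assms by (rule openin_open_Int)
  then have "openin (subtopology X (fst c)) {q \<in> fst c. snd c q \<in> chart_image c \<inter> V}"
    using openin_continuous_map_preimage[OF homeomorphic_imp_continuous_map[OF chart_homeomorphic]]
    unfolding chart_topspace by blast
  moreover have "{q \<in> fst c. snd c q \<in> chart_image c \<inter> V} = {q \<in> fst c. snd c q \<in> V}"
    by (auto simp: chart_image_def)
  ultimately show ?thesis
    using openin_trans_full[OF _ chart_domain_open] by simp
qed

end

section \<open>Tangent vectors on a smooth manifold\<close>

context
  fixes X :: "'a topology" and A :: "('a, 'n::finite) chart set"
  assumes manifold: "smooth_manifold X A"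
begin

lemma atlas_chart: "c \<in> A \<Longrightarrow> topological_chart X c"
  using manifold by (simp add: smooth_manifold_def)

lemma smooth_fun_on_subset:
  "smooth_fun_on A U f \<Longrightarrow> V \<subseteq> U \<Longrightarrow> smooth_fun_on A V f"
  unfolding smooth_fun_on_def smooth_on_def by (blast intro: Ck_on_subset)

text \<open>Coordinate vectors are cut off to 0 on functions that are not smooth near \<open>p\<close>; their linearity
  and product rule therefore need smoothness near \<open>p\<close> of sums and products.\<close>

lemma smooth_near_combine:
  assumes f: "smooth_near X A p f" and h: "smooth_near X A p h"
    and F: "\<And>k S (u :: real ^ 'n \<Rightarrow> real) v. open S \<Longrightarrow> Ck_on k u S \<Longrightarrow> Ck_on k v S
        \<Longrightarrow> Ck_on k (\<lambda>x. F (u x) (v x)) S"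
  shows "smooth_near X A p (\<lambda>q. F (f q) (h q))"
proof -
  obtain U V where U: "openin X U" "p \<in> U" "smooth_fun_on A U f"
    and V: "openin X V" "p \<in> V" "smooth_fun_on A V h"
    using f h by (auto simp: smooth_near_def)
  have "smooth_fun_on A (U \<inter> V) (\<lambda>q. F (f q) (h q))"
    unfolding smooth_fun_on_def smooth_on_def
  proof (intro ballI allI)
    fix d k assume d: "d \<in> A"
    let ?S = "snd d ` (fst d \<inter> (U \<inter> V))"
    have "open ?S"
      using chart_open_image[OF atlas_chart[OF d]] U(1) V(1) by blast
    moreover have "Ck_on k (in_chart d f) ?S"
      using smooth_fun_on_subset[OF U(3), of "U \<inter> V"] d by (auto simp: smooth_fun_on_def smooth_on_def)
    moreover have "Ck_on k (in_chart d h) ?S"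
      using smooth_fun_on_subset[OF V(3), of "U \<inter> V"] d by (auto simp: smooth_fun_on_def smooth_on_def)
    ultimately have "Ck_on k (\<lambda>x. F (in_chart d f x) (in_chart d h x)) ?S"
      by (rule F)
    then show "Ck_on k (in_chart d (\<lambda>q. F (f q) (h q))) ?S"
      by (simp add: in_chart_def o_def)
  qed
  then show ?thesis
    using U V unfolding smooth_near_def by (intro exI[of _ "U \<inter> V"]) auto
qed

lemma smooth_near_linear:
  assumes "smooth_near X A p f" "smooth_near X A p h"
  shows "smooth_near X A p (\<lambda>q. a * f q + b * h q)"
  by (rule smooth_near_combine[OF assms, of "\<lambda>s t. a * s + b * t"])
    (intro Ck_on_add Ck_on_mult Ck_on_const)

lemma smooth_near_mult:
  assumes "smooth_near X A p f" "smooth_near X A p h"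
  shows "smooth_near X A p (\<lambda>q. f q * h q)"
  by (rule smooth_near_combine[OF assms, of "\<lambda>s t. s * t"]) (intro Ck_on_mult)

lemma smooth_near_differentiable:
  assumes "smooth_near X A p f" "c \<in> A" "p \<in> fst c"
  shows "in_chart c f differentiable (at (snd c p))"
proof -
  obtain U where U: "p \<in> U" "smooth_fun_on A U f"
    using assms by (auto simp: smooth_near_def)
  then have "Ck_on 2 (in_chart c f) (snd c ` (fst c \<inter> U))"
    using assms(2) by (simp add: smooth_fun_on_def smooth_on_imp_C2)
  moreover have "snd c p \<in> snd c ` (fst c \<inter> U)"
    using U assms by blast
  ultimately show ?thesis
    by (rule C2_on_partial(1))
qed

lemma coord_vec_in_tangent_space:
  assumes c: "c \<in> A" "p \<in> fst c"
  shows "coord_vec X A c p i \<in> tangent_space X A p"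
proof -
  have comp: "in_chart c (\<lambda>q. F (f q) (h q)) = (\<lambda>y. F (in_chart c f y) (in_chart c h y))" for F f h
    by (simp add: in_chart_def o_def)
  have app: "in_chart c f (snd c p) = f p" for f :: "'a \<Rightarrow> real"
    by (rule in_chart_apply[OF chart_inj[OF atlas_chart[OF c(1)]] c(2)])
  note d = smooth_near_differentiable[OF _ c]
  have "coord_vec X A c p i (\<lambda>q. a * f q + b * h q)
      = a * coord_vec X A c p i f + b * coord_vec X A c p i h"
    if "smooth_near X A p f" "smooth_near X A p h" for f h a b
    using that smooth_near_linear[OF that, of a b] comp[of "\<lambda>s t. a * s + b * t" f h]
    by (simp add: coord_vec_def partial_add partial_cmult d)
  moreover have "coord_vec X A c p i (\<lambda>q. f q * h q)
      = f p * coord_vec X A c p i h + h p * coord_vec X A c p i f"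
    if "smooth_near X A p f" "smooth_near X A p h" for f h
    using that smooth_near_mult[OF that] comp[of "\<lambda>s t. s * t" f h]
    by (simp add: coord_vec_def partial_mult d app)
  ultimately show ?thesis
    by (simp add: tangent_space_def coord_vec_def)
qed

text \<open>The coordinate functions of a chart are smooth near its points, and separate its coordinate
  vectors.\<close>

lemma coord_vec_coordinate:
  assumes c: "c \<in> A" "p \<in> fst c"
  shows "coord_vec X A c p i (\<lambda>q. snd c q $ j) = mat 1 $ i $ j"
proof -
  note chart = atlas_chart[OF c(1)]
  let ?x = "\<lambda>q. snd c q $ j"
  have "smooth_fun_on A (fst c) ?x"
    unfolding smooth_fun_on_def smooth_on_def
  proof (intro ballI allI)
    fix d k assume d: "d \<in> A"
    have "Ck_on k (in_chart d (snd c)) (snd d ` (fst d \<inter> fst c))"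
      using manifold c(1) d by (simp add: smooth_manifold_def smooth_on_def)
    then have "Ck_on k (\<lambda>y. in_chart d (snd c) y $ j) (snd d ` (fst d \<inter> fst c))"
      by (rule Ck_on_component[OF chart_open_image[OF atlas_chart[OF d] chart_domain_open[OF chart]]])
    then show "Ck_on k (in_chart d ?x) (snd d ` (fst d \<inter> fst c))"
      by (simp add: in_chart_def o_def)
  qed
  then have near: "smooth_near X A p ?x"
    using chart_domain_open[OF chart] c(2) by (auto simp: smooth_near_def)
  have "partial i (in_chart c ?x) (snd c p) = partial i (\<lambda>y. y $ j) (snd c p)"
  proof (rule partial_cong)
    show "open (chart_image c)" "snd c p \<in> chart_image c"
      using chart c(2) by (auto simp: topological_chart_def chart_image_def)
    show "in_chart c ?x y = y $ j" if "y \<in> chart_image c" for y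
      using that by (auto simp: chart_image_def in_chart_apply[OF chart_inj[OF chart]])
  qed
  also have "\<dots> = axis i 1 $ j"
    by (rule partialI) (rule bounded_linear_imp_has_derivative[OF bounded_linear_vec_nth])
  finally show ?thesis
    using near by (simp add: coord_vec_def axis_def mat_def)
qed

lemma tangent_space_zero: "(\<lambda>f. 0) \<in> tangent_space X A p"
  by (simp add: tangent_space_def)

lemma tangent_space_linear:
  assumes "u \<in> tangent_space X A p" "v \<in> tangent_space X A p"
  shows "(\<lambda>f. a * u f + b * v f) \<in> tangent_space X A p"
  using assms unfolding tangent_space_def by (simp add: algebra_simps)

lemma chart_image_lift:
  assumes "c \<in> A" "y \<in> chart_image c"
  obtains p where "p \<in> fst c" "y = snd c p" "p \<in> topspace X"
  using assms openin_subset[OF chart_domain_open[OF atlas_chart[OF assms(1)]]]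
  by (auto simp: chart_image_def)

context
  fixes g :: "'a \<Rightarrow> 'a tvec \<Rightarrow> 'a tvec \<Rightarrow> real"
  assumes metric: "riemannian_metric X A g"
begin

lemma metric_symmetric:
  "p \<in> topspace X \<Longrightarrow> u \<in> tangent_space X A p \<Longrightarrow> v \<in> tangent_space X A p \<Longrightarrow> g p u v = g p v u"
  using metric unfolding riemannian_metric_def by blast

lemma metric_positive:
  "p \<in> topspace X \<Longrightarrow> v \<in> tangent_space X A p \<Longrightarrow> v \<noteq> (\<lambda>f. 0) \<Longrightarrow> g p v v > 0"
  using metric unfolding riemannian_metric_def by blast

lemma metric_linear:
  assumes "p \<in> topspace X" "u \<in> tangent_space X A p" "v \<in> tangent_space X A p"
    "w \<in> tangent_space X A p"
  shows "g p (\<lambda>f. a * u f + b * v f) w = a * g p u w + b * g p v w"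
  using metric assms unfolding riemannian_metric_def by simp

lemma metric_chart_entry:
  assumes "c \<in> A" "p \<in> fst c"
  shows "metric_in_chart X A g c (snd c p) $ i $ j = g p (coord_vec X A c p i) (coord_vec X A c p j)"
  by (simp add: metric_in_chart_def
      in_chart_apply[OF chart_inj[OF atlas_chart[OF assms(1)]] assms(2)])

lemma metric_combination:
  assumes "p \<in> topspace X" and w: "w \<in> tangent_space X A p"
    and e: "\<And>i. i \<in> I \<Longrightarrow> e i \<in> tangent_space X A p" and "finite I"
  shows "(\<lambda>f. \<Sum>i\<in>I. a i * e i f) \<in> tangent_space X A p \<and>
    g p (\<lambda>f. \<Sum>i\<in>I. a i * e i f) w = (\<Sum>i\<in>I. a i * g p (e i) w)"
  using \<open>finite I\<close> e
proof (induction I)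
  case empty
  show ?case
    using metric_linear[OF assms(1) w w w, of 0 0] by (simp add: tangent_space_zero)
next
  case (insert i I)
  let ?v = "\<lambda>f. \<Sum>i\<in>I. a i * e i f"
  have v: "?v \<in> tangent_space X A p" "g p ?v w = (\<Sum>i\<in>I. a i * g p (e i) w)"
    and ei: "e i \<in> tangent_space X A p"
    using insert by auto
  show ?case
    using tangent_space_linear[OF ei v(1), of "a i" 1]
      metric_linear[OF assms(1) ei v(1) w, of "a i" 1] insert.hyps v(2) by simp
qed

text \<open>A vector in the kernel of the matrix of \<open>g\<close> gives a tangent vector of length zero, which
  vanishes by positivity and then has vanishing coordinates.\<close>

lemma metric_in_chart_local_metric:
  assumes c: "c \<in> A" and U: "open U" "U \<subseteq> chart_image c"
  shows "local_metric U (metric_in_chart X A g c)"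
proof
  show "open U" by fact
  show "Ck_on 2 (metric_in_chart X A g c) U"
    using metric c U(2) smooth_on_imp_C2 Ck_on_subset unfolding riemannian_metric_def by blast
next
  fix y assume "y \<in> U"
  with U(2) c obtain p where p: "p \<in> fst c" "y = snd c p" "p \<in> topspace X"
    using chart_image_lift by blast
  define e where "e = coord_vec X A c p"
  have e: "e i \<in> tangent_space X A p" for i
    unfolding e_def by (rule coord_vec_in_tangent_space[OF c p(1)])
  have G: "metric_in_chart X A g c y $ i $ j = g p (e i) (e j)" for i j
    unfolding p(2) e_def by (rule metric_chart_entry[OF c p(1)])
  note sym = metric_symmetric[OF p(3)]
  show "metric_in_chart X A g c y $ i $ j = metric_in_chart X A g c y $ j $ i" for i j
    unfolding G by (rule sym[OF e e])
  have "a = 0" if a: "metric_in_chart X A g c y *v a = 0" for a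
  proof -
    define v where "v = (\<lambda>f. \<Sum>i\<in>UNIV. a $ i * e i f)"
    have comb: "v \<in> tangent_space X A p \<and> g p v w = (\<Sum>i\<in>UNIV. a $ i * g p (e i) w)"
      if "w \<in> tangent_space X A p" for w
      unfolding v_def by (rule metric_combination[OF p(3) that e finite])
    have v: "v \<in> tangent_space X A p"
      using comb[OF tangent_space_zero] by blast
    have "g p v (e i) = 0" for i
    proof -
      have "g p v (e i) = (metric_in_chart X A g c y *v a) $ i"
        by (simp add: conjunct2[OF comb[OF e]] matrix_vector_mult_def G sym[OF e e, of _ i] mult.commute)
      then show ?thesis by (simp add: a)
    qed
    then have "g p v v = 0"
      using comb[OF v] sym[OF e v] by simp
    then have "v = (\<lambda>f. 0)"
      using metric_positive[OF p(3) v] by auto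
    then have "(\<Sum>i\<in>UNIV. a $ i * e i (\<lambda>q. snd c q $ j)) = 0" for j
      unfolding v_def by metis
    then show "a = 0"
      by (simp add: e_def coord_vec_coordinate[OF c p(1)] sum_delta vec_eq_iff)
  qed
  then show "invertible (metric_in_chart X A g c y)"
    unfolding invertible_left_inverse matrix_left_invertible_ker by blast
qed

end

lemma smooth_fun_nonzero_open:
  assumes f: "smooth_fun_on A (topspace X) f"
  shows "openin X {p \<in> topspace X. f p \<noteq> 0}"
proof (subst openin_subopen, intro ballI)
  fix p assume p: "p \<in> {p \<in> topspace X. f p \<noteq> 0}"
  then have "p \<in> (\<Union>c\<in>A. fst c)"
    using manifold by (simp add: smooth_manifold_def)
  then obtain c where c: "c \<in> A" "p \<in> fst c"
    by blast
  note chart = atlas_chart[OF c(1)]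
  have sub: "fst c \<subseteq> topspace X"
    using openin_subset[OF chart_domain_open[OF chart]] .
  then have "fst c \<inter> topspace X = fst c" by auto
  then have "Ck_on 0 (in_chart c f) (chart_image c)"
    using f c(1) unfolding smooth_fun_on_def smooth_on_def chart_image_def by metis
  then have "open {y \<in> chart_image c. in_chart c f y \<in> - {0}}"
    using chart continuous_open_preimage[of "chart_image c" "in_chart c f" "- {0}"]
      open_Compl[OF closed_singleton[of "0 :: real"]]
    by (simp add: topological_chart_def vimage_def Int_def)
  from chart_open_preimage[OF chart this]
  have "openin X {q \<in> fst c. snd c q \<in> {y \<in> chart_image c. in_chart c f y \<in> - {0}}}" .
  also have "{q \<in> fst c. snd c q \<in> {y \<in> chart_image c. in_chart c f y \<in> - {0}}} = {q \<in> fst c. f q \<noteq> 0}"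
    by (auto simp: chart_image_def in_chart_apply[OF chart_inj[OF chart]]
        dest: inj_onD[OF chart_inj[OF chart]])
  finally show "\<exists>T. openin X T \<and> p \<in> T \<and> T \<subseteq> {p \<in> topspace X. f p \<noteq> 0}"
    using p c(2) sub by (intro exI[of _ "{q \<in> fst c. f q \<noteq> 0}"]) auto
qed

section \<open>Restriction to an open subset\<close>

text \<open>Passing to \<open>S\<close> changes the topology, the charts and with them the cutoff in the coordinate
  vectors. Smoothness near a point of \<open>S\<close> is unaffected, so the coordinate vectors are the same
  functionals and a metric can be evaluated on them without restricting it.\<close>

context
  fixes S :: "'a set"
  assumes S: "openin X S"
begin

lemma in_chart_restrict:
  assumes "c \<in> A" "y \<in> snd c ` (fst c \<inter> S)"
  shows "in_chart (fst c \<inter> S, snd c) f y = in_chart c f y"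
proof -
  note inj = chart_inj[OF atlas_chart[OF assms(1)]]
  obtain p where p: "p \<in> fst c" "p \<in> S" "y = snd c p"
    using assms(2) by blast
  have "in_chart (fst c \<inter> S, snd c) f (snd c p) = f p"
    using in_chart_apply[of "(fst c \<inter> S, snd c)" p f] inj p by (auto intro: inj_on_subset)
  then show ?thesis
    by (simp add: in_chart_apply[OF inj p(1)] p(3))
qed

lemma smooth_fun_on_restrict:
  assumes W: "openin X W" "W \<subseteq> S"
  shows "smooth_fun_on (restrict_atlas S A) W f \<longleftrightarrow> smooth_fun_on A W f"
proof -
  have "smooth_on (in_chart (fst d \<inter> S, snd d) f) (snd d ` (fst d \<inter> S \<inter> W))
    \<longleftrightarrow> smooth_on (in_chart d f) (snd d ` (fst d \<inter> W))" if d: "d \<in> A" for d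
  proof -
    have "fst d \<inter> S \<inter> W = fst d \<inter> W" using W(2) by auto
    moreover have "Ck_on k (in_chart (fst d \<inter> S, snd d) f) (snd d ` (fst d \<inter> W))
      \<longleftrightarrow> Ck_on k (in_chart d f) (snd d ` (fst d \<inter> W))" for k
    proof (rule Ck_on_cong[OF chart_open_image[OF atlas_chart[OF d] W(1)]])
      fix y assume "y \<in> snd d ` (fst d \<inter> W)"
      then show "in_chart (fst d \<inter> S, snd d) f y = in_chart d f y"
        using W(2) by (intro in_chart_restrict[OF d]) auto
    qed
    ultimately show ?thesis
      by (simp add: smooth_on_def)
  qed
  then show ?thesis
    by (simp add: smooth_fun_on_def restrict_atlas_def)
qed

lemma smooth_near_restrict:
  assumes "p \<in> S"
  shows "smooth_near (subtopology X S) (restrict_atlas S A) p f \<longleftrightarrow> smooth_near X A p f"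
proof
  assume "smooth_near (subtopology X S) (restrict_atlas S A) p f"
  then obtain U where "openin X U" "U \<subseteq> S" "p \<in> U" "smooth_fun_on (restrict_atlas S A) U f"
    using openin_open_subtopology[OF S] by (auto simp: smooth_near_def)
  then show "smooth_near X A p f"
    using smooth_fun_on_restrict by (auto simp: smooth_near_def)
next
  assume "smooth_near X A p f"
  then obtain U where U: "openin X U" "p \<in> U" "smooth_fun_on A U f"
    by (auto simp: smooth_near_def)
  have "openin X (U \<inter> S)"
    using U(1) S by blast
  then have "smooth_fun_on (restrict_atlas S A) (U \<inter> S) f" "openin (subtopology X S) (U \<inter> S)"
    using smooth_fun_on_restrict[of "U \<inter> S"] smooth_fun_on_subset[OF U(3), of "U \<inter> S"]
      openin_open_subtopology[OF S] by auto
  then show "smooth_near (subtopology X S) (restrict_atlas S A) p f"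
    using U(2) assms by (auto simp: smooth_near_def)
qed

lemma coord_vec_restrict:
  assumes c: "c \<in> A" and p: "p \<in> fst c \<inter> S"
  shows "coord_vec (subtopology X S) (restrict_atlas S A) (fst c \<inter> S, snd c) p i = coord_vec X A c p i"
proof
  fix f
  have "partial i (in_chart (fst c \<inter> S, snd c) f) (snd c p) = partial i (in_chart c f) (snd c p)"
    by (rule partial_cong[OF chart_open_image[OF atlas_chart[OF c] S]])
      (use p in_chart_restrict[OF c] in auto)
  then show "coord_vec (subtopology X S) (restrict_atlas S A) (fst c \<inter> S, snd c) p i f = coord_vec X A c p i f"
    using p smooth_near_restrict[of p f] by (simp add: coord_vec_def)
qed

lemma metric_in_chart_restrict:
  assumes c: "c \<in> A" and y: "y \<in> snd c ` (fst c \<inter> S)"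
  shows "metric_in_chart (subtopology X S) (restrict_atlas S A) g (fst c \<inter> S, snd c) y
    = metric_in_chart X A g c y"
proof -
  obtain p where p: "p \<in> fst c \<inter> S" "y = snd c p"
    using y by blast
  have app: "in_chart c F (snd c p) = F p" for F :: "'a \<Rightarrow> real ^ 'n ^ 'n"
    by (rule in_chart_apply[OF chart_inj[OF atlas_chart[OF c]]]) (use p(1) in blast)
  show ?thesis
    unfolding metric_in_chart_def in_chart_restrict[OF c y]
    unfolding p(2) app coord_vec_restrict[OF c p(1)] ..
qed

end

end

section \<open>The conformal pair\<close>

lemma metric_in_chart_scale:
  "metric_in_chart X A (\<lambda>p v w. g p v w / (t p)\<^sup>2) c y
    = (1 / (in_chart c t y)\<^sup>2) *\<^sub>R metric_in_chart X A g c y"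
  by (simp add: metric_in_chart_def in_chart_def vec_eq_iff)

theorem proposition2p1:
  fixes X :: "'a topology" and A :: "('a, 'n::finite) chart set"
    and g g' :: "'a \<Rightarrow> 'a tvec \<Rightarrow> 'a tvec \<Rightarrow> real"
    and \<tau> \<tau>' \<alpha> \<gamma> :: "'a \<Rightarrow> real"
    and X' :: "'a topology" and A' :: "('a, 'n) chart set" and S :: "'a set"
  assumes "riemannian_manifold X A g"
    and "CARD('n) > 3"
    and "smooth_fun_on A (topspace X) \<tau>" and "\<not> \<tau> constant_on topspace X"
    and "smooth_fun_on A (topspace X) \<alpha>" and "smooth_fun_on A (topspace X) \<gamma>"
    and "\<And>c x i j. c \<in> A \<Longrightarrow> x \<in> chart_image c \<Longrightarrow>
      in_chart c \<alpha> x * hessian (metric_in_chart X A g c) (in_chart c \<tau>) i j x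
        + ricci (metric_in_chart X A g c) i j x
      = in_chart c \<gamma> x * metric_in_chart X A g c x $ i $ j"
  defines "S \<equiv> {p \<in> topspace X. \<tau> p \<noteq> 0}"
    and "X' \<equiv> subtopology X S" and "A' \<equiv> restrict_atlas S A"
    and "g' \<equiv> \<lambda>p v w. g p v w / (\<tau> p)\<^sup>2" and "\<tau>' \<equiv> \<lambda>p. 1 / \<tau> p"
  shows "\<forall>c\<in>A'. \<forall>x\<in>chart_image c. \<forall>i j.
    (let G = metric_in_chart X' A' g c; G' = metric_in_chart X' A' g' c;
         a = in_chart c \<alpha> x; t = in_chart c \<tau> x;
         Q = grad_square G (in_chart c \<tau>) x; \<Delta> = laplacian G (in_chart c \<tau>) x;
         \<alpha>' = (real CARD('n) - 2) * t - t\<^sup>2 * a;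
         \<gamma>' = in_chart c \<gamma> x * t\<^sup>2 - (1 + a * t) * Q + t * \<Delta>
     in \<alpha>' * hessian G' (in_chart c \<tau>') i j x + ricci G' i j x = \<gamma>' * G' x $ i $ j)"
proof (intro ballI allI)
  fix c' x i j assume "c' \<in> A'" and x': "x \<in> chart_image c'"
  then obtain c where c: "c \<in> A" and c': "c' = (fst c \<inter> S, snd c)"
    by (auto simp: A'_def restrict_atlas_def)
  have M: "smooth_manifold X A" and g: "riemannian_metric X A g"
    using assms(1) by (simp_all add: riemannian_manifold_def)
  note chart = atlas_chart[OF M c]
  have S: "openin X S"
    unfolding S_def by (rule smooth_fun_nonzero_open[OF M assms(3)])
  \<comment> \<open>On \<open>U\<close> all data of the restricted manifold agree with those of the chart \<open>c\<close>. Agreement on an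
    open set, not only at \<open>x\<close>, is what the derivatives in the tensors require.\<close>
  define U where "U = snd c ` (fst c \<inter> S)"
  have U: "open U" "U \<subseteq> chart_image c" "x \<in> U"
    using chart_open_image[OF chart S] x' by (auto simp: U_def chart_image_def c')
  define G where "G = metric_in_chart X A g c"
  define t where "t = in_chart c \<tau>"
  interpret local_metric U G
    unfolding G_def by (rule metric_in_chart_local_metric[OF M g c U(1,2)])
  have t: "Ck_on 2 t U"
  proof -
    have "U \<subseteq> snd c ` (fst c \<inter> topspace X)"
      by (auto simp: U_def S_def)
    moreover have "Ck_on 2 t (snd c ` (fst c \<inter> topspace X))"
      using assms(3) c by (simp add: smooth_fun_on_def smooth_on_imp_C2 t_def)
    ultimately show ?thesis by (rule Ck_on_subset[rotated])
  qed
  have nz: "t y \<noteq> 0" if "y \<in> U" for y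
    using that by (auto simp: U_def S_def t_def in_chart_apply[OF chart_inj[OF chart]])
  have loc: "in_chart c' f y = in_chart c f y" if "y \<in> U" for f :: "'a \<Rightarrow> real" and y
    using in_chart_restrict[OF M S c] that by (simp add: c' U_def)
  have G_loc: "metric_in_chart X' A' g c' y = G y" if "y \<in> U" for y
    using metric_in_chart_restrict[OF M S c] that by (simp add: c' U_def X'_def A'_def G_def)
  have G'_loc: "metric_in_chart X' A' g' c' y = (1 / (t y)\<^sup>2) *\<^sub>R G y" if "y \<in> U" for y
    unfolding g'_def metric_in_chart_scale G_loc[OF that] loc[OF that] t_def ..
  have \<tau>'_loc: "in_chart c' \<tau>' y = 1 / t y" if "y \<in> U" for y
    unfolding loc[OF that] by (simp add: t_def \<tau>'_def in_chart_def)
  let ?G' = "metric_in_chart X' A' g' c'"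
  have "hessian ?G' (in_chart c' \<tau>') i j x = hessian ?G' (\<lambda>y. 1 / t y) i j x"
    by (rule hessian_cong[OF U(1) refl \<tau>'_loc U(3)])
  moreover have "grad_square (metric_in_chart X' A' g c') (in_chart c' \<tau>) x = grad_square G t x"
    by (rule grad_square_cong[OF U(1) G_loc loc[of _ \<tau>, folded t_def] U(3)])
  moreover have "laplacian (metric_in_chart X' A' g c') (in_chart c' \<tau>) x = laplacian G t x"
    by (rule laplacian_cong[OF U(1) G_loc loc[of _ \<tau>, folded t_def] U(3)])
  moreover have "in_chart c \<alpha> x * hessian G t i j x + ricci G i j x = in_chart c \<gamma> x * G x $ i $ j"
    unfolding G_def t_def by (rule assms(7)[OF c]) (use U in blast)
  note hessian_ricci_equation_divided_by_square[OF t nz G'_loc U(3) this]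
  ultimately show "let G = metric_in_chart X' A' g c'; G' = metric_in_chart X' A' g' c';
         a = in_chart c' \<alpha> x; t = in_chart c' \<tau> x;
         Q = grad_square G (in_chart c' \<tau>) x; \<Delta> = laplacian G (in_chart c' \<tau>) x;
         \<alpha>' = (real CARD('n) - 2) * t - t\<^sup>2 * a;
         \<gamma>' = in_chart c' \<gamma> x * t\<^sup>2 - (1 + a * t) * Q + t * \<Delta>
     in \<alpha>' * hessian G' (in_chart c' \<tau>') i j x + ricci G' i j x = \<gamma>' * G' x $ i $ j"
    unfolding Let_def loc[OF U(3)] t_def by simp
qed

end
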